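(* Let $d\ge2$, let $k$ be an integer with $0<k<d$, and suppose $0<p<p_c$. There exists $\alpha=\alpha(p,k,d)>0$ such that $$\mu(T_n)\le \exp\{-\alpha\cdot n\}\quad\text{for all integers } n\ge1,$$ where $T_n=T_n(k,d)=\{\gamma\in\mathcal{G}:\beta_k(\gamma)\ge n\}$.
   Context: For $x\in\mathbb{Z}^d$ and a positive integer $\ell$ let $B_\ell(x)=\prod_{i=1}^d[x_i,x_i+\ell]$. Each point of $\mathbb{Z}^d$ is independently colored black with probability $p\in(0,1)$ and white with probability $1-p$; $Z$ is the random set of black points, and $\Phi=\big(\bigcup_{z\in Z}B_1(z)\big)^{\circ}$ is the interior (in $\mathbb{R}^d$) of the union of the black unit cubes. Let $C_0$ be the (possibly empty) connected component of $\Phi$ containing the interior of $B_1(0)$, $|C_0|$ the number of unit cubes in it, $\theta(p)=\mathbb{P}\{|C_0|=\infty\}$, and $p_c=\inf\{p:\theta(p)>0\}$ the critical probability. $\mathcal{G}$ denotes the (countable) set of equivalence classes, up to homotopy equivalence, of finite connected $d$-dimensional cubical complexes, i.e. of nonempty connected sets of the form $\big(\bigcup_{z\in F}B_1(z)\big)^{\circ}$ with $F\subset\mathbb{Z}^d$ finite. For $\gamma\in\mathcal{G}$, $\beta_k(\gamma)$ is the $k$th Betti number of $\gamma$. For a positive integer $L$, let $W_L(0)=\prod_{i=1}^d[-\lfloor L/2\rfloor,\lceil L/2\rceil]$, let $\Phi_L$ be the union of the connected components of $\Phi$ completely contained in $W_L(0)$, and let $b_0(\Phi_L)$ be the number of its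 components. Let $\mu_L=\frac{1}{b_0(\Phi_L)}\sum_{s}\delta_{[s]}$, the sum being over connected components $s$ of $\Phi_L$, with $[s]\in\mathcal{G}$ the homotopy type of $s$ (on the event $b_0(\Phi_L)=0$, $\mu_L$ is an arbitrary fixed probability measure on $\mathcal{G}$). As $L\to\infty$ the random measures $\mu_L$ converge in probability, with respect to total variation distance, to a deterministic probability measure on $\mathcal{G}$; this limit (which depends on $p$ and $d$) is denoted $\mu$. *)

theory Defs
  imports "HOL-Homology.Homology" "HOL-Probability.Probability"
begin

definition cube :: "nat \<Rightarrow> int ^ 'd \<Rightarrow> (real ^ 'd) set" where
  "cube l x = cbox (\<chi> i. real_of_int (x $ i)) (\<chi> i. real_of_int (x $ i) + real l)"

definition cubical_set :: "(int ^ 'd) set \<Rightarrow> (real ^ 'd) set" where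
  "cubical_set Z = interior (\<Union>z\<in>Z. cube 1 z)"

text \<open>A colouring \<open>\<omega>\<close> is a Boolean function on the lattice, \<open>True\<close> meaning black.\<close>

definition site_measure :: "real \<Rightarrow> (int ^ 'd \<Rightarrow> bool) measure" where
  "site_measure p = PiM UNIV (\<lambda>_. measure_pmf (bernoulli_pmf p))"

definition black :: "(int ^ 'd \<Rightarrow> bool) \<Rightarrow> (int ^ 'd) set" where
  "black \<omega> = {z. \<omega> z}"

text \<open>The union below has at most one member: it is the component containing the open unit
  cube at the origin if there is one, and empty otherwise.\<close>

definition origin_component :: "(int ^ 'd) set \<Rightarrow> (real ^ 'd) set" where
  "origin_component Z = \<Union>{C \<in> components (cubical_set Z). interior (cube 1 0) \<subseteq> C}"

text \<open>A unit cube belongs to an open cubical set when its interior is contained in it.\<close>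

definition unit_cubes_in :: "(real ^ 'd) set \<Rightarrow> (int ^ 'd) set" where
  "unit_cubes_in S = {z. interior (cube 1 z) \<subseteq> S}"

definition theta :: "'d::finite itself \<Rightarrow> real \<Rightarrow> real" where
  "theta _ p = measure (site_measure p)
     {\<omega> \<in> space (site_measure p).
        infinite (unit_cubes_in (origin_component (black \<omega>) :: (real ^ 'd) set))}"

text \<open>The range of \<open>p\<close> is made explicit because \<^const>\<open>bernoulli_pmf\<close> clips its parameter to
  the unit interval; the value at 1 is 1, so the set is never empty.\<close>

definition critical_probability :: "'d::finite itself \<Rightarrow> real" where
  "critical_probability t = Inf {p \<in> {0..1}. theta t p > 0}"

definition complexes :: "(real ^ 'd) set set" where
  "complexes = {S. S \<noteq> {} \<and> connected S \<and> (\<exists>F. finite F \<and> S = cubical_set F)}"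

definition homotopy_rel :: "((real ^ 'd) set \<times> (real ^ 'd) set) set" where
  "homotopy_rel = {(S, T). S \<in> complexes \<and> T \<in> complexes \<and> S homotopy_eqv T}"

definition homotopy_types :: "(real ^ 'd) set set set" where
  "homotopy_types = complexes // homotopy_rel"

definition homotopy_type :: "(real ^ 'd) set \<Rightarrow> (real ^ 'd) set set" where
  "homotopy_type S = homotopy_rel `` {S}"

lemma equiv_homotopy_rel: "equiv complexes homotopy_rel"
proof (rule equivI)
  show "homotopy_rel \<subseteq> complexes \<times> complexes"
    by (auto simp: homotopy_rel_def)
  show "refl_on complexes homotopy_rel"
    by (auto simp: homotopy_rel_def refl_on_def homotopy_equivalent_space_refl)
  show "sym homotopy_rel"
    unfolding homotopy_rel_def sym_def
    using homotopy_equivalent_space_sym by blast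
  show "trans homotopy_rel"
    unfolding homotopy_rel_def trans_def
    by clarify (erule (1) homotopy_eqv_trans)
qed

text \<open>The rank of a (multiplicatively written) abelian group: the largest number of
  elements that are linearly independent over the integers.\<close>

definition int_independent :: "('a, 'b) monoid_scheme \<Rightarrow> 'a set \<Rightarrow> bool" where
  "int_independent G B \<longleftrightarrow> finite B \<and> B \<subseteq> carrier G \<and>
     (\<forall>c :: 'a \<Rightarrow> int. finprod G (\<lambda>x. x [^]\<^bsub>G\<^esub> c x) B = \<one>\<^bsub>G\<^esub> \<longrightarrow> (\<forall>x\<in>B. c x = 0))"

definition abelian_rank :: "('a, 'b) monoid_scheme \<Rightarrow> enat" where
  "abelian_rank G = (SUP B \<in> {B. int_independent G B}. enat (card B))"

definition betti :: "nat \<Rightarrow> (real ^ 'd) set \<Rightarrow> enat" where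
  "betti k S = abelian_rank (homology_group (int k) (top_of_set S))"

definition betti_type :: "nat \<Rightarrow> (real ^ 'd) set set \<Rightarrow> enat" where
  "betti_type k \<gamma> = betti k (SOME S. S \<in> \<gamma>)"

lemma int_independent_image:
  assumes G: "comm_group G" and H: "comm_group H" and h: "h \<in> iso G H"
    and B: "int_independent G B"
  shows "int_independent H (h ` B) \<and> card (h ` B) = card B"
proof -
  interpret G: comm_group G by fact
  interpret H: comm_group H by fact
  have hom: "h \<in> hom G H" and inj: "inj_on h (carrier G)"
    using h by (auto simp: iso_def bij_betw_def)
  have fin: "finite B" and sub: "B \<subseteq> carrier G"
    and ind: "\<And>c :: _ \<Rightarrow> int. finprod G (\<lambda>x. x [^]\<^bsub>G\<^esub> c x) B = \<one>\<^bsub>G\<^esub> \<Longrightarrow> \<forall>x\<in>B. c x = 0"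
    using B by (auto simp: int_independent_def)
  have injB: "inj_on h B" using inj sub by (rule inj_on_subset)
  have hcl: "h x \<in> carrier H" if "x \<in> carrier G" for x using hom that by (rule hom_in_carrier)
  have prod: "h (finprod G f A) = finprod H (\<lambda>x. h (f x)) A"
    if "finite A" "f \<in> A \<rightarrow> carrier G" for f A
    using that
  proof (induction A rule: finite_induct)
    case empty
    show ?case using hom G.group_axioms H.group_axioms by (simp add: hom_one)
  next
    case (insert a A)
    then have "f \<in> A \<rightarrow> carrier G" "f a \<in> carrier G" by auto
    moreover have "(\<lambda>x. h (f x)) \<in> A \<rightarrow> carrier H" using calculation(1) hcl by auto
    ultimately show ?case
      using insert hom_mult[OF hom] hcl by (simp add: G.finprod_closed)
  qed
  have "\<forall>y\<in>h ` B. c y = 0"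
    if c: "finprod H (\<lambda>y. y [^]\<^bsub>H\<^esub> c y) (h ` B) = \<one>\<^bsub>H\<^esub>" for c :: "_ \<Rightarrow> int"
  proof -
    let ?f = "\<lambda>x. x [^]\<^bsub>G\<^esub> c (h x)"
    have f: "?f \<in> B \<rightarrow> carrier G" using sub by auto
    have "finprod H (\<lambda>y. y [^]\<^bsub>H\<^esub> c y) (h ` B) = finprod H (\<lambda>x. h x [^]\<^bsub>H\<^esub> c (h x)) B"
      using injB sub hcl by (intro H.finprod_reindex) auto
    also have "\<dots> = finprod H (\<lambda>x. h (?f x)) B"
      using sub hcl hom G.group_axioms H.group_axioms
      by (intro H.finprod_cong') (auto simp: hom_int_pow)
    also have "\<dots> = h (finprod G ?f B)" using prod[OF fin f] by simp
    finally have "h (finprod G ?f B) = h \<one>\<^bsub>G\<^esub>"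
      using c hom G.group_axioms H.group_axioms by (simp add: hom_one)
    then have "finprod G ?f B = \<one>\<^bsub>G\<^esub>"
      using inj G.finprod_closed[OF f] by (auto dest: inj_onD)
    from ind[OF this] show ?thesis by auto
  qed
  then show ?thesis
    using fin sub hcl injB by (auto simp: int_independent_def card_image)
qed

lemma abelian_rank_le:
  assumes "comm_group G" "comm_group H" "G \<cong> H"
  shows "abelian_rank G \<le> abelian_rank H"
proof -
  obtain h where "h \<in> iso G H" using assms(3) by (auto simp: is_iso_def)
  then show ?thesis
    unfolding abelian_rank_def
    by (intro SUP_mono) (metis int_independent_image[OF assms(1,2)] mem_Collect_eq order_refl)
qed

lemma betti_homotopy_eqv:
  fixes S T :: "(real ^ 'd) set"
  assumes "S homotopy_eqv T"
  shows "betti k S = betti k T"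
proof -
  have le: "betti k S \<le> betti k T" if "S homotopy_eqv T" for S T :: "(real ^ 'd) set"
    unfolding betti_def
    by (rule abelian_rank_le[OF abelian_homology_group abelian_homology_group
          homotopy_equivalent_space_imp_isomorphic_homology_groups[OF that]])
  show ?thesis
    using le[OF assms] le[OF iffD1[OF homotopy_equivalent_space_sym assms]] by (rule antisym)
qed

lemma betti_type_homotopy_type:
  assumes "S \<in> complexes"
  shows "betti_type k (homotopy_type S) = betti k S"
proof -
  have "S \<in> homotopy_type S"
    using equiv_class_self[OF equiv_homotopy_rel assms] by (simp add: homotopy_type_def)
  then have "(SOME T. T \<in> homotopy_type S) \<in> homotopy_type S" by (rule someI)
  then have "S homotopy_eqv (SOME T. T \<in> homotopy_type S)"
    unfolding homotopy_type_def homotopy_rel_def by blast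
  then show ?thesis
    unfolding betti_type_def by (rule betti_homotopy_eqv[symmetric])
qed

definition betti_tail :: "nat \<Rightarrow> nat \<Rightarrow> (real ^ 'd) set set set" where
  "betti_tail k n = {\<gamma> \<in> homotopy_types. betti_type k \<gamma> \<ge> enat n}"

definition window :: "nat \<Rightarrow> (real ^ 'd) set" where
  "window L = cbox (\<chi> i. - real_of_int \<lfloor>real L / 2\<rfloor>) (\<chi> i. real_of_int \<lceil>real L / 2\<rceil>)"

definition windowed_set :: "nat \<Rightarrow> (int ^ 'd) set \<Rightarrow> (real ^ 'd) set" where
  "windowed_set L Z = \<Union>{C \<in> components (cubical_set Z). C \<subseteq> window L}"

text \<open>Probability measures on the countable discrete set of homotopy types are represented as
  \<open>pmf\<close>s supported on that set. The image of the uniform distribution on the components is the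
  normalised sum of the point masses at their types; \<open>\<nu>\<close> is the arbitrary value taken when
  there are no components.\<close>

definition empirical_measure ::
    "(real ^ 'd) set set pmf \<Rightarrow> nat \<Rightarrow> (int ^ 'd) set \<Rightarrow> (real ^ 'd) set set pmf" where
  "empirical_measure \<nu> L Z =
     (if components (windowed_set L Z) = {} then \<nu>
      else map_pmf homotopy_type (pmf_of_set (components (windowed_set L Z))))"

definition tv_dist :: "'a pmf \<Rightarrow> 'a pmf \<Rightarrow> real" where
  "tv_dist P Q = (SUP A. \<bar>measure_pmf.prob P A - measure_pmf.prob Q A\<bar>)"

definition is_limit_measure ::
    "real \<Rightarrow> (real ^ 'd) set set pmf \<Rightarrow> (real ^ 'd) set set pmf \<Rightarrow> bool" where
  "is_limit_measure p \<nu> \<mu> \<longleftrightarrow> set_pmf \<mu> \<subseteq> homotopy_types \<and>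
     (\<forall>\<epsilon>>0. (\<lambda>L. measure (site_measure p)
        {\<omega> \<in> space (site_measure p). tv_dist (empirical_measure \<nu> L (black \<omega>)) \<mu> > \<epsilon>})
      \<longlonglongrightarrow> 0)"

end

theory Submission
  imports Defs
begin

text \<open>Nearest-neighbour clusters of black sites correspond to the connected components of the
cubical set, so a component with many holes must be a large cluster, and large clusters are
exponentially rare below the critical probability.

Holes are bounded linearly by volume. A point lies in the cubical set of \<open>F\<close> exactly when
every unit cube through it belongs to \<open>F\<close> (\<open>cubical_set_eq\<close>), so the cubical set is covered by
the open stars of its cells. These are open boxes, there are at most a constant times \<open>card F\<close>
of them, and each meets a bounded number of others. Adding them one at a time and using the
subadditivity of rank in exact sequences together with excision
(\<open>homology_rank_sparse_convex_cover\<close>) gives \<open>betti_le_card\<close>: every Betti number is at most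
\<open>D * card F\<close>.

Volumes decay exponentially. Take \<open>q\<close> between \<open>p\<close> and the critical value, so that
clusters at \<open>q\<close> are almost surely finite. Mark each site independently with a small
probability \<open>1 - s\<close>. At \<open>q\<close> the cluster of the origin carries no mark with probability close to
one, and conditioning on this event lowers the density seen by an exploration of the cluster only
slightly: the conditioned cluster still dominates the cluster at \<open>p\<close>
(\<open>conditioned_exploration_dominates\<close>). But an unmarked cluster of size at least \<open>m\<close> has
probability at most \<open>s ^ m\<close>. This comparison is due to Vanneuville; it yields
\<open>subcritical_volume_decay\<close>.

It remains to compare with the number of components in a window. Isolated black cubes have a fixed
positive density \<open>\<rho>\<close>, so the expected number of clusters of size at least \<open>m\<close> is an exponentially
small multiple of the expected number of isolated cubes. Since the limit \<open>\<mu>\<close> is deterministic,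
a bound on the empirical measure that holds with probability bounded away from zero passes to \<open>\<mu>\<close>
(\<open>limit_measure_le\<close>), and a bound on a first moment provides such an event
(\<open>favourable_event\<close>). This proves
\<open>\<mu> (T n) \<le> C * s ^ (n div D)\<close>. The isolated cubes have no holes, whence also
\<open>\<mu> (T n) \<le> 1 - \<rho> / 2\<close> for \<open>n \<ge> 1\<close>; the second bound absorbs the constant \<open>C\<close> for
small \<open>n\<close> (\<open>exponential_bound\<close>).\<close>

section \<open>Clusters in a graph\<close>

text \<open>The set \<open>S\<close> is the part of a cluster that is already explored and counts as occupied
whether or not it meets \<open>A\<close>; only the sites entered later have to lie in \<open>A\<close>.\<close>

definition cluster :: "('v \<Rightarrow> 'v \<Rightarrow> bool) \<Rightarrow> 'v set \<Rightarrow> 'v set \<Rightarrow> 'v set" where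
  "cluster E S A = {(x, y). E x y \<and> y \<in> A}\<^sup>* `` S"

lemma cluster_subset: "cluster E S A \<subseteq> S \<union> A"
proof
  fix y assume "y \<in> cluster E S A"
  then obtain x where "x \<in> S" "(x, y) \<in> {(x, y). E x y \<and> y \<in> A}\<^sup>*"
    by (auto simp: cluster_def)
  from this(2,1) show "y \<in> S \<union> A" by induction auto
qed

lemma cluster_contains: "S \<subseteq> cluster E S A"
  by (auto simp: cluster_def)

lemma cluster_step: "x \<in> cluster E S A \<Longrightarrow> E x y \<Longrightarrow> y \<in> A \<Longrightarrow> y \<in> cluster E S A"
  unfolding cluster_def by (auto intro: rtrancl_into_rtrancl)

lemma cluster_least:
  assumes "S \<subseteq> T" "\<And>x y. x \<in> T \<Longrightarrow> E x y \<Longrightarrow> y \<in> A \<Longrightarrow> y \<in> T"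
  shows "cluster E S A \<subseteq> T"
proof
  fix y assume "y \<in> cluster E S A"
  then obtain x where "x \<in> S" "(x, y) \<in> {(x, y). E x y \<and> y \<in> A}\<^sup>*"
    by (auto simp: cluster_def)
  from this(2,1) show "y \<in> T" by induction (auto intro: subsetD[OF assms(1)] assms(2))
qed

lemma cluster_mono: "S \<subseteq> T \<Longrightarrow> A \<subseteq> B \<Longrightarrow> cluster E S A \<subseteq> cluster E T B"
  by (rule cluster_least) (use cluster_contains[of T E B] cluster_step[of _ E T B] in auto)

lemma cluster_Un: "cluster E (S \<union> T) A = cluster E S A \<union> cluster E T A"
  by (auto simp: cluster_def)

text \<open>A path that returns to \<open>v\<close> can be started afresh at \<open>v\<close>.\<close>

lemma cluster_remove:
  assumes "v \<in> S"
  shows "cluster E S (A - {v}) = cluster E S A"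
proof
  show "cluster E S (A - {v}) \<subseteq> cluster E S A" by (intro cluster_mono) auto
  show "cluster E S A \<subseteq> cluster E S (A - {v})"
  proof (rule cluster_least[OF cluster_contains])
    fix x y assume "x \<in> cluster E S (A - {v})" "E x y" "y \<in> A"
    then show "y \<in> cluster E S (A - {v})"
      using assms cluster_contains[of S E "A - {v}"] cluster_step[of x E S "A - {v}" y] by (cases "y = v") auto
  qed
qed

lemma cluster_subset_self: "z \<in> Z \<Longrightarrow> cluster E {z} Z \<subseteq> Z"
  using cluster_subset[of E "{z}" Z] by auto

lemma cluster_self: "z \<in> cluster E {z} A"
  using cluster_contains[of "{z}" E A] by simp

text \<open>Every step has to land in \<open>Z\<close>, so a path can be reversed only because its starting
point is itself occupied.\<close>

lemma cluster_sym:
  assumes "\<And>x y. E x y \<Longrightarrow> E y x" "z \<in> Z" "w \<in> cluster E {z} Z"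
  shows "cluster E {w} Z = cluster E {z} Z"
proof -
  have trans: "cluster E {y} Z \<subseteq> cluster E {x} Z" if "y \<in> cluster E {x} Z" for x y
    by (rule cluster_least) (use that cluster_step in auto)
  have "cluster E {z} Z \<subseteq> {w \<in> Z. z \<in> cluster E {w} Z}"
  proof (rule cluster_least)
    show "{z} \<subseteq> {w \<in> Z. z \<in> cluster E {w} Z}" using assms(2) cluster_self by auto
    fix x y assume x: "x \<in> {w \<in> Z. z \<in> cluster E {w} Z}" and "E x y" and y: "y \<in> Z"
    then have "x \<in> cluster E {y} Z"
      using cluster_step[OF cluster_self, of E y x Z] assms(1) by auto
    then show "y \<in> {w \<in> Z. z \<in> cluster E {w} Z}" using trans x y by blast
  qed
  then show ?thesis using trans assms(3) by blast
qed

text \<open>A path inside the cluster never leaves \<open>W\<close>. Hence a cluster contained in a window can be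
read off from the colours in the window.\<close>

lemma cluster_restrict:
  assumes "cluster E S A \<subseteq> W"
  shows "cluster E S (A \<inter> W) = cluster E S A"
proof
  show "cluster E S (A \<inter> W) \<subseteq> cluster E S A" by (intro cluster_mono) auto
  have "cluster E S A \<subseteq> cluster E S (A \<inter> W) \<inter> cluster E S A"
  proof (rule cluster_least)
    show "S \<subseteq> cluster E S (A \<inter> W) \<inter> cluster E S A" by (simp add: cluster_contains)
    fix x y assume x: "x \<in> cluster E S (A \<inter> W) \<inter> cluster E S A" and xy: "E x y" "y \<in> A"
    then have y: "y \<in> cluster E S A" using cluster_step[of x E S A y] by auto
    then show "y \<in> cluster E S (A \<inter> W) \<inter> cluster E S A"
      using x xy assms cluster_step[of x E S "A \<inter> W" y] by auto
  qed
  then show "cluster E S A \<subseteq> cluster E S (A \<inter> W)" by blast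
qed

text \<open>Paths are finite; this makes events about clusters countable combinations of events about
single sites.\<close>

lemma cluster_finite_witness:
  assumes "w \<in> cluster E {z} A"
  shows "\<exists>F. finite F \<and> F \<subseteq> A \<and> w \<in> cluster E {z} F"
proof -
  have "cluster E {z} A \<subseteq> {w. \<exists>F. finite F \<and> F \<subseteq> A \<and> w \<in> cluster E {z} F}"
  proof (rule cluster_least)
    show "{z} \<subseteq> {w. \<exists>F. finite F \<and> F \<subseteq> A \<and> w \<in> cluster E {z} F}"
      using cluster_self[of z E "{}"] by auto
    fix x y assume "x \<in> {w. \<exists>F. finite F \<and> F \<subseteq> A \<and> w \<in> cluster E {z} F}" and y: "E x y" "y \<in> A"
    then obtain F where F: "finite F" "F \<subseteq> A" "x \<in> cluster E {z} F" by auto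
    then have "x \<in> cluster E {z} (insert y F)" using cluster_mono[of "{z}" "{z}" F "insert y F" E] by auto
    then have "y \<in> cluster E {z} (insert y F)" using y(1) by (rule cluster_step) simp
    then show "y \<in> {w. \<exists>F. finite F \<and> F \<subseteq> A \<and> w \<in> cluster E {z} F}" using F y by blast
  qed
  then show ?thesis using assms by blast
qed

lemma cluster_image:
  assumes "\<And>x y. E (t x) (t y) \<longleftrightarrow> E x y"
  shows "cluster E (t ` S) (t ` A) = t ` cluster E S A"
proof
  show "cluster E (t ` S) (t ` A) \<subseteq> t ` cluster E S A"
    by (rule cluster_least) (use cluster_contains assms cluster_step in \<open>fastforce\<close>)+
  have "cluster E S A \<subseteq> t -` cluster E (t ` S) (t ` A)"
  proof (rule cluster_least)
    show "S \<subseteq> t -` cluster E (t ` S) (t ` A)" using cluster_contains[of "t ` S" E] by blast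
    fix x y assume "x \<in> t -` cluster E (t ` S) (t ` A)" "E x y" "y \<in> A"
    then show "y \<in> t -` cluster E (t ` S) (t ` A)"
      using cluster_step[of "t x" E "t ` S" "t ` A" "t y"] assms by simp
  qed
  then show "t ` cluster E S A \<subseteq> cluster E (t ` S) (t ` A)" by blast
qed

lemma finite_cluster: "finite S \<Longrightarrow> finite A \<Longrightarrow> finite (cluster E S A)"
  by (meson cluster_subset finite_UnI finite_subset)

text \<open>One step of an exploration: when the neighbour \<open>v\<close> is found to be occupied it joins the
explored part, and only the states of the remaining sites stay undecided.\<close>

lemma cluster_explore:
  assumes "u \<in> S" "E u v"
  shows "cluster E S (insert v A) = cluster E (insert v S) A"
proof -
  have "v \<in> cluster E S (insert v A)"
    using assms cluster_contains by (meson cluster_step insertI1 subsetD)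
  then have "cluster E (insert v S) (insert v A) \<subseteq> cluster E S (insert v A)"
    using cluster_contains[of S E "insert v A"] cluster_step[of _ E S "insert v A"]
    by (intro cluster_least) auto
  moreover have "cluster E S (insert v A) \<subseteq> cluster E (insert v S) (insert v A)"
    by (intro cluster_mono) auto
  moreover have "cluster E (insert v S) (insert v A) = cluster E (insert v S) A"
    using cluster_remove[of v "insert v S" E A] cluster_remove[of v "insert v S" E "insert v A"] by simp
  ultimately show ?thesis by auto
qed

section \<open>Exponential decay of the cluster volume in finite percolation\<close>

text \<open>The expectation of \<open>f\<close> at the random subset of \<open>V\<close> that contains each site independently
with probability \<open>p\<close>. As a finite sum it admits inductions over \<open>V\<close> that condition on one site
at a time.\<close>

definition site_expectation :: "real \<Rightarrow> 'v set \<Rightarrow> ('v set \<Rightarrow> real) \<Rightarrow> real" where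
  "site_expectation p V f = (\<Sum>A\<in>Pow V. p ^ card A * (1 - p) ^ card (V - A) * f A)"

lemma site_expectation_empty [simp]: "site_expectation p {} f = f {}"
  by (simp add: site_expectation_def)

lemma site_expectation_insert:
  assumes "finite V" "v \<notin> V"
  shows "site_expectation p (insert v V) f = p * site_expectation p V (\<lambda>A. f (insert v A)) + (1 - p) * site_expectation p V f"
proof -
  have inj: "inj_on (insert v) (Pow V)" using assms(2) by (auto simp: inj_on_def)
  have "site_expectation p (insert v V) f =
      (\<Sum>A\<in>Pow V. p ^ card A * (1 - p) ^ card (insert v V - A) * f A)
    + (\<Sum>A\<in>insert v ` Pow V. p ^ card A * (1 - p) ^ card (insert v V - A) * f A)"
    unfolding site_expectation_def Pow_insert using assms by (intro sum.union_disjoint) auto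
  also have "(\<Sum>A\<in>Pow V. p ^ card A * (1 - p) ^ card (insert v V - A) * f A) = (1 - p) * site_expectation p V f"
    unfolding site_expectation_def sum_distrib_left
  proof (intro sum.cong refl)
    fix A assume "A \<in> Pow V"
    then have "insert v V - A = insert v (V - A)" "v \<notin> V - A" using assms by auto
    then show "p ^ card A * (1 - p) ^ card (insert v V - A) * f A
        = (1 - p) * (p ^ card A * (1 - p) ^ card (V - A) * f A)"
      using assms by simp
  qed
  also have "(\<Sum>A\<in>insert v ` Pow V. p ^ card A * (1 - p) ^ card (insert v V - A) * f A)
      = p * site_expectation p V (\<lambda>A. f (insert v A))"
    unfolding site_expectation_def sum_distrib_left sum.reindex[OF inj] o_def
  proof (intro sum.cong refl)
    fix A assume "A \<in> Pow V"
    then have "insert v V - insert v A = V - A" "v \<notin> A" "finite A"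
      using assms by (auto intro: finite_subset)
    then show "p ^ card (insert v A) * (1 - p) ^ card (insert v V - insert v A) * f (insert v A)
        = p * (p ^ card A * (1 - p) ^ card (V - A) * f (insert v A))"
      by simp
  qed
  finally show ?thesis by simp
qed

lemma site_expectation_mono:
  assumes "0 \<le> p" "p \<le> 1" "\<And>A. A \<subseteq> V \<Longrightarrow> f A \<le> g A"
  shows "site_expectation p V f \<le> site_expectation p V g"
  unfolding site_expectation_def using assms by (intro sum_mono mult_left_mono) auto

lemma site_expectation_cong: "(\<And>A. A \<subseteq> V \<Longrightarrow> f A = g A) \<Longrightarrow> site_expectation p V f = site_expectation p V g"
  unfolding site_expectation_def by (intro sum.cong) auto

lemma site_expectation_cmult: "site_expectation p V (\<lambda>A. c * f A) = c * site_expectation p V f"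
  unfolding site_expectation_def sum_distrib_left by (intro sum.cong) auto

lemma site_expectation_add: "site_expectation p V (\<lambda>A. f A + g A) = site_expectation p V f + site_expectation p V g"
  unfolding site_expectation_def by (simp add: sum.distrib[symmetric] algebra_simps)

lemma site_expectation_const: "finite V \<Longrightarrow> site_expectation p V (\<lambda>A. c) = c"
  by (induction V rule: finite_induct) (auto simp: site_expectation_insert algebra_simps)

lemma site_expectation_image:
  assumes "inj t"
  shows "site_expectation p (t ` V) f = site_expectation p V (\<lambda>A. f (t ` A))"
proof -
  have "site_expectation p (t ` V) f = (\<Sum>A\<in>(`) t ` Pow V. p ^ card A * (1 - p) ^ card (t ` V - A) * f A)"
    unfolding site_expectation_def image_Pow_surj[OF refl, symmetric] ..
  also have "\<dots> = (\<Sum>A\<in>Pow V. p ^ card (t ` A) * (1 - p) ^ card (t ` V - t ` A) * f (t ` A))"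
    using assms by (subst sum.reindex) (auto simp: inj_on_def inj_image_eq_iff)
  also have "\<dots> = site_expectation p V (\<lambda>A. f (t ` A))"
    unfolding site_expectation_def using assms
    by (intro sum.cong refl) (simp add: image_set_diff[symmetric] card_image inj_on_subset[OF assms subset_UNIV])
  finally show ?thesis .
qed

text \<open>Harris' inequality: decreasing functions are positively correlated. Condition on the state
of \<open>v\<close>. The conditional expectations of \<open>f\<close> and of \<open>g\<close> both decrease when \<open>v\<close> becomes occupied, so
the product of the two differences is nonnegative, which is the covariance contributed by \<open>v\<close>.\<close>

lemma site_expectation_harris:
  assumes "finite V" and p: "0 \<le> p" "p \<le> 1"
    and "\<And>A B. A \<subseteq> B \<Longrightarrow> B \<subseteq> V \<Longrightarrow> f B \<le> f A"
    and "\<And>A B. A \<subseteq> B \<Longrightarrow> B \<subseteq> V \<Longrightarrow> g B \<le> g A"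
  shows "site_expectation p V f * site_expectation p V g \<le> site_expectation p V (\<lambda>A. f A * g A)"
  using assms(1,4,5)
proof (induction V arbitrary: f g rule: finite_induct)
  case (insert v V)
  let ?f = "\<lambda>A. f (insert v A)" and ?g = "\<lambda>A. g (insert v A)"
  have f: "site_expectation p V ?f \<le> site_expectation p V f" by (rule site_expectation_mono[OF p]) (auto intro: insert.prems)
  have g: "site_expectation p V ?g \<le> site_expectation p V g" by (rule site_expectation_mono[OF p]) (auto intro: insert.prems)
  have "p * (1 - p) * ((site_expectation p V f - site_expectation p V ?f) * (site_expectation p V g - site_expectation p V ?g)) \<ge> 0"
    using f g p by simp
  then have "(p * site_expectation p V ?f + (1 - p) * site_expectation p V f) * (p * site_expectation p V ?g + (1 - p) * site_expectation p V g)
      \<le> p * (site_expectation p V ?f * site_expectation p V ?g) + (1 - p) * (site_expectation p V f * site_expectation p V g)"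
    by (simp add: algebra_simps)
  also have "\<dots> \<le> p * site_expectation p V (\<lambda>A. ?f A * ?g A) + (1 - p) * site_expectation p V (\<lambda>A. f A * g A)"
    using p by (intro add_mono mult_left_mono insert.IH) (auto intro!: insert.prems)
  finally show ?case using insert.hyps by (simp add: site_expectation_insert)
qed simp

text \<open>Mark every site independently with probability \<open>1 - s\<close>; then \<open>s ^ card K\<close> is the
probability that a set \<open>K\<close> carries no mark. The clusters of \<open>S\<close> and of \<open>T\<close> being unmarked are two
decreasing events, so they are positively correlated.\<close>

lemma cluster_cost_submultiplicative:
  fixes s :: real
  assumes "finite R" "finite S" "finite T" "0 \<le> p" "p \<le> 1" "0 \<le> s" "s \<le> 1"
  shows "site_expectation p R (\<lambda>A. s ^ card (cluster E S A)) * site_expectation p R (\<lambda>A. s ^ card (cluster E T A))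
    \<le> site_expectation p R (\<lambda>A. s ^ card (cluster E (S \<union> T) A))"
proof -
  have anti: "s ^ card (cluster E S B) \<le> s ^ card (cluster E S A)"
    if "A \<subseteq> B" "B \<subseteq> R" "finite S" for A B S
    using that assms
    by (intro power_decreasing card_mono finite_cluster cluster_mono) (auto intro: finite_subset)
  have "site_expectation p R (\<lambda>A. s ^ card (cluster E S A)) * site_expectation p R (\<lambda>A. s ^ card (cluster E T A))
    \<le> site_expectation p R (\<lambda>A. s ^ card (cluster E S A) * s ^ card (cluster E T A))"
    using assms anti by (intro site_expectation_harris) auto
  also have "\<dots> \<le> site_expectation p R (\<lambda>A. s ^ card (cluster E (S \<union> T) A))"
    unfolding cluster_Un power_add[symmetric]
    by (intro site_expectation_mono power_decreasing card_Un_le assms)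
  finally show ?thesis .
qed

text \<open>With the marks of probability \<open>1 - s\<close>, dividing by the second factor on the left turns
the claim into a comparison: conditioned on carrying no mark, the cluster at density \<open>p\<close> is at
least as likely to have size at least \<open>n\<close> as the unconditioned cluster at density \<open>q\<close>.

The proof reveals one neighbour \<open>v\<close> of the explored part at a time. Let \<open>a\<^sub>1\<close> and \<open>a\<^sub>0\<close> be the
probabilities that the final cluster is unmarked when \<open>v\<close> is occupied and when it is vacant. Under
the conditioning \<open>v\<close> is occupied with probability \<open>p * a\<^sub>1 / (p * a\<^sub>1 + (1 - p) * a\<^sub>0)\<close>. The
denominator is at most \<open>a\<^sub>0\<close>, and \<open>a\<^sub>1\<close> is at least \<open>\<delta> * a\<^sub>0\<close> because an occupied \<open>v\<close> only adds its
own cluster, which is unmarked with probability at least \<open>\<delta>\<close>. So this probability is at least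
\<open>p * \<delta>\<close>, hence at least \<open>q\<close>.\<close>

lemma conditioned_exploration_dominates:
  fixes s :: real
  assumes p: "0 \<le> p" "p \<le> 1" and s: "0 \<le> s" "s \<le> 1" and q: "0 \<le> q" "q \<le> p * \<delta>"
    and low: "\<And>v R. finite R \<Longrightarrow> v \<notin> R \<Longrightarrow> \<delta> \<le> site_expectation p R (\<lambda>A. s ^ card (cluster E {v} A))"
    and "finite R" "finite S" "S \<inter> R = {}"
  shows "site_expectation q R (\<lambda>A. of_bool (n \<le> card (cluster E S A))) * site_expectation p R (\<lambda>A. s ^ card (cluster E S A))
    \<le> site_expectation p R (\<lambda>A. of_bool (n \<le> card (cluster E S A)) * s ^ card (cluster E S A))"
  using assms(8-10)
proof (induction "card R" arbitrary: R S)
  case 0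
  then show ?case by simp
next
  case (Suc m)
  show ?case
  proof (cases "\<exists>u\<in>S. \<exists>v\<in>R. E u v")
    case False
    then have "cluster E S A = S" if "A \<subseteq> R" for A
      using that cluster_contains[of S E A] cluster_least[of S S E A] by blast
    then have "site_expectation r R (\<lambda>A. f (cluster E S A)) = f S" for f :: "_ \<Rightarrow> real" and r
      using site_expectation_cong[of R "\<lambda>A. f (cluster E S A)" "\<lambda>A. f S" r] Suc.prems by (simp add: site_expectation_const)
    from this[of q "\<lambda>C. of_bool (n \<le> card C)"] this[of p "\<lambda>C. s ^ card C"]
      this[of p "\<lambda>C. of_bool (n \<le> card C) * s ^ card C"]
    show ?thesis by simp
  next
    case True
    then obtain u v where uv: "u \<in> S" "v \<in> R" "E u v" by auto
    define R' where "R' = R - {v}"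
    have R': "R = insert v R'" "v \<notin> R'" "finite R'" "card R' = m"
      using uv Suc by (auto simp: R'_def)
    let ?N = "\<lambda>S. site_expectation q R' (\<lambda>A. of_bool (n \<le> card (cluster E S A)))"
    let ?a = "\<lambda>S. site_expectation p R' (\<lambda>A. s ^ card (cluster E S A))"
    let ?b = "\<lambda>S. site_expectation p R' (\<lambda>A. of_bool (n \<le> card (cluster E S A)) * s ^ card (cluster E S A))"
    let ?S = "insert v S"
    have split: "site_expectation r R (\<lambda>A. f (cluster E S A))
        = r * site_expectation r R' (\<lambda>A. f (cluster E ?S A)) + (1 - r) * site_expectation r R' (\<lambda>A. f (cluster E S A))"
      for f :: "_ \<Rightarrow> real" and r
      unfolding R'(1) site_expectation_insert[OF R'(3,2)] cluster_explore[where E = E, OF uv(1) uv(3)] ..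
    have IH1: "?N ?S * ?a ?S \<le> ?b ?S" using R' Suc.prems by (intro Suc.hyps) auto
    have IH0: "?N S * ?a S \<le> ?b S" using R' Suc.prems by (intro Suc.hyps) auto
    have fin: "finite (cluster E ?S A)" "finite (cluster E S A)" if "A \<subseteq> R'" for A
      using that R' Suc.prems by (auto intro!: finite_cluster intro: finite_subset)
    have sub: "card (cluster E S A) \<le> card (cluster E ?S A)" if "A \<subseteq> R'" for A
      using fin[OF that] by (intro card_mono cluster_mono) auto
    have a0: "0 \<le> ?a S" using site_expectation_mono[OF p, of R' "\<lambda>_. 0" "\<lambda>A. s ^ card (cluster E S A)"] s R'
      by (simp add: site_expectation_const)
    have a10: "?a ?S \<le> ?a S" using sub s by (intro site_expectation_mono p power_decreasing) auto
    have "\<delta> * ?a S \<le> ?a {v} * ?a S" using low[OF R'(3,2)] a0 by (rule mult_right_mono)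
    also have "\<dots> \<le> ?a ?S"
      using cluster_cost_submultiplicative[of R' "{v}" S p s E] R' Suc.prems p s by simp
    finally have a1: "\<delta> * ?a S \<le> ?a ?S" .
    have "\<delta> \<le> 1"
      using low[OF R'(3,2)] site_expectation_mono[OF p, of R' "\<lambda>A. s ^ card (cluster E {v} A)" "\<lambda>_. 1"] s R'
      by (force simp: site_expectation_const power_le_one)
    then have q1: "q \<le> 1" using q p
      by (meson dual_order.trans mult_left_le)
    have N: "?N S \<le> ?N ?S" using sub q1 q by (intro site_expectation_mono) (auto dest: order_trans)
    have "q * (p * ?a ?S + (1 - p) * ?a S) \<le> q * ?a S"
    proof -
      have "p * ?a ?S \<le> p * ?a S" using a10 p by (intro mult_left_mono)
      then show ?thesis using q by (intro mult_left_mono) (auto simp: algebra_simps)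
    qed
    also have "\<dots> \<le> p * \<delta> * ?a S" using q a0 by (intro mult_right_mono)
    also have "\<dots> \<le> p * ?a ?S" using a1 p by (metis mult.assoc mult_left_mono)
    \<comment> \<open>The conditional probability that \<open>v\<close> is occupied, given no mark, is at least \<open>q\<close>.\<close>
    finally have key: "q * (p * ?a ?S + (1 - p) * ?a S) \<le> p * ?a ?S" .
    have "(q * ?N ?S + (1 - q) * ?N S) * (p * ?a ?S + (1 - p) * ?a S)
      = ?N S * (p * ?a ?S + (1 - p) * ?a S) + (?N ?S - ?N S) * (q * (p * ?a ?S + (1 - p) * ?a S))"
      by (simp add: algebra_simps)
    also have "\<dots> \<le> ?N S * (p * ?a ?S + (1 - p) * ?a S) + (?N ?S - ?N S) * (p * ?a ?S)"
      using key N by (intro add_left_mono mult_left_mono) auto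
    also have "\<dots> = p * (?N ?S * ?a ?S) + (1 - p) * (?N S * ?a S)"
      by (simp add: algebra_simps)
    also have "\<dots> \<le> p * ?b ?S + (1 - p) * ?b S"
      using IH1 IH0 p by (intro add_mono mult_left_mono) auto
    finally show ?thesis
      using split[of q "\<lambda>C. of_bool (n \<le> card C)"] split[of p "\<lambda>C. s ^ card C"]
        split[of p "\<lambda>C. of_bool (n \<le> card C) * s ^ card C"]
      by simp
  qed
qed

text \<open>The probability at \<open>q\<close> is at most the conditional probability at \<open>p\<close>: a cluster of size at least
\<open>n\<close> is unmarked with probability at most \<open>s ^ n\<close>, and the conditioning event has probability at
least \<open>\<delta>\<close>.\<close>

lemma cluster_volume_decay:
  fixes s :: real
  assumes p: "0 \<le> p" "p \<le> 1" and s: "0 \<le> s" "s \<le> 1" and q: "0 \<le> q" "q \<le> p * \<delta>" and "0 < \<delta>"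
    and low: "\<And>v R. finite R \<Longrightarrow> v \<notin> R \<Longrightarrow> \<delta> \<le> site_expectation p R (\<lambda>A. s ^ card (cluster E {v} A))"
    and R: "finite R" "v \<notin> R"
  shows "site_expectation q R (\<lambda>A. of_bool (n \<le> card (cluster E {v} A))) \<le> s ^ n / \<delta>"
proof -
  let ?N = "site_expectation q R (\<lambda>A. of_bool (n \<le> card (cluster E {v} A)))"
  have \<delta>1: "\<delta> \<le> 1"
    using low[OF R] site_expectation_mono[OF p, of R "\<lambda>A. s ^ card (cluster E {v} A)" "\<lambda>_. 1"] s R
    by (force simp: site_expectation_const power_le_one)
  have "q \<le> 1" using q p \<delta>1 by (meson dual_order.trans mult_left_le)
  then have "0 \<le> ?N"
    using site_expectation_mono[of q R "\<lambda>_. 0" "\<lambda>A. of_bool (n \<le> card (cluster E {v} A))"] q R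
    by (simp add: site_expectation_const)
  then have "?N * \<delta> \<le> ?N * site_expectation p R (\<lambda>A. s ^ card (cluster E {v} A))"
    using low[OF R] by (intro mult_left_mono)
  also have "\<dots> \<le> site_expectation p R (\<lambda>A. of_bool (n \<le> card (cluster E {v} A)) * s ^ card (cluster E {v} A))"
    using conditioned_exploration_dominates[OF p s q low] R by auto
  also have "\<dots> \<le> site_expectation p R (\<lambda>_. s ^ n)"
    using p s by (intro site_expectation_mono) (auto intro: power_decreasing)
  finally show ?thesis using R \<open>0 < \<delta>\<close> by (simp add: site_expectation_const field_simps)
qed

section \<open>Ranks of homology groups\<close>

definition int_lincomb :: "('a, 'm) monoid_scheme \<Rightarrow> ('i \<Rightarrow> 'a) \<Rightarrow> ('i \<Rightarrow> int) \<Rightarrow> 'i set \<Rightarrow> 'a" where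
  "int_lincomb G x c I = finprod G (\<lambda>i. x i [^]\<^bsub>G\<^esub> c i) I"

text \<open>Independence of indexed families, which spares the later arguments a discussion of
repeated elements.\<close>

definition int_independent_family :: "('a, 'm) monoid_scheme \<Rightarrow> ('i \<Rightarrow> 'a) \<Rightarrow> 'i set \<Rightarrow> bool" where
  "int_independent_family G x I \<longleftrightarrow> finite I \<and> x ` I \<subseteq> carrier G \<and>
     (\<forall>c. int_lincomb G x c I = \<one>\<^bsub>G\<^esub> \<longrightarrow> (\<forall>i\<in>I. c i = 0))"

context comm_group
begin

lemma int_lincomb_closed: "x ` I \<subseteq> carrier G \<Longrightarrow> int_lincomb G x c I \<in> carrier G"
  unfolding int_lincomb_def by (intro finprod_closed) auto

lemma int_lincomb_insert:
  assumes "finite I" "i \<notin> I" "x ` insert i I \<subseteq> carrier G"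
  shows "int_lincomb G x c (insert i I) = x i [^] c i \<otimes> int_lincomb G x c I"
  unfolding int_lincomb_def using assms by (intro finprod_insert) auto

lemma int_lincomb_zero:
  assumes "\<And>i. i \<in> I \<Longrightarrow> c i = 0"
  shows "int_lincomb G x c I = \<one>"
  unfolding int_lincomb_def by (rule finprod_one_eqI) (simp add: assms)

lemma int_lincomb_cong:
  assumes "x ` I \<subseteq> carrier G" "\<And>i. i \<in> I \<Longrightarrow> c i = d i"
  shows "int_lincomb G x c I = int_lincomb G x d I"
  unfolding int_lincomb_def using assms by (intro finprod_cong') auto

lemma int_lincomb_extend:
  assumes "finite J" "I \<subseteq> J" "x ` J \<subseteq> carrier G" "\<And>i. i \<in> J - I \<Longrightarrow> c i = 0"
  shows "int_lincomb G x c I = int_lincomb G x c J"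
  unfolding int_lincomb_def
  by (rule finprod_mono_neutral_cong_left) (use assms in auto)

lemma int_lincomb_add:
  assumes "finite I" "x ` I \<subseteq> carrier G"
  shows "int_lincomb G x c I [^] (d::int) \<otimes> int_lincomb G x e I
    = int_lincomb G x (\<lambda>i. c i * d + e i) I"
  using assms
proof (induction I rule: finite_induct)
  case empty
  then show ?case by (simp add: int_lincomb_def)
next
  case (insert i I)
  have x: "x i \<in> carrier G" and I: "x ` I \<subseteq> carrier G" using insert.prems by auto
  have L: "int_lincomb G x c I \<in> carrier G" for c using I by (rule int_lincomb_closed)
  have "(x i [^] c i \<otimes> int_lincomb G x c I) [^] d \<otimes> (x i [^] e i \<otimes> int_lincomb G x e I)
      = (x i [^] (c i * d) \<otimes> x i [^] e i) \<otimes> (int_lincomb G x c I [^] d \<otimes> int_lincomb G x e I)"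
    using x L by (simp add: int_pow_distrib int_pow_pow m_ac)
  also have "\<dots> = x i [^] (c i * d + e i) \<otimes> int_lincomb G x (\<lambda>i. c i * d + e i) I"
    using x insert.IH[OF I] by (simp add: int_pow_mult)
  finally show ?case using insert by (simp add: int_lincomb_insert)
qed

text \<open>Substituting linear combinations into a linear combination multiplies the coefficient
matrices.\<close>

lemma int_lincomb_int_lincomb:
  assumes "finite I" "finite T" "x ` I \<subseteq> carrier G"
  shows "int_lincomb G (\<lambda>s. int_lincomb G x (c s) I) d T
    = int_lincomb G x (\<lambda>i. \<Sum>s\<in>T. c s i * d s) I"
  using assms(2)
proof (induction T rule: finite_induct)
  case empty
  have "int_lincomb G x (\<lambda>i. 0) I = \<one>" by (rule int_lincomb_zero) simp
  then show ?case by (simp add: int_lincomb_def[of _ _ _ "{}"])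
next
  case (insert s T)
  have "int_lincomb G (\<lambda>s. int_lincomb G x (c s) I) d (insert s T)
    = int_lincomb G x (c s) I [^] d s \<otimes> int_lincomb G x (\<lambda>i. \<Sum>s\<in>T. c s i * d s) I"
    using insert assms by (subst int_lincomb_insert) (auto intro!: int_lincomb_closed)
  then show ?case
    using insert.hyps assms by (simp add: int_lincomb_add)
qed

text \<open>An independent family is injective, since a repetition \<open>x i = x j\<close> would be the relation
with coefficients \<open>1\<close> and \<open>-1\<close>.\<close>

lemma card_le_abelian_rank:
  assumes "int_independent_family G x I"
  shows "enat (card I) \<le> abelian_rank G"
proof -
  have fin: "finite I" and x: "x ` I \<subseteq> carrier G"
    and ind: "\<And>c i. int_lincomb G x c I = \<one> \<Longrightarrow> i \<in> I \<Longrightarrow> c i = 0"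
    using assms by (auto simp: int_independent_family_def)
  have inj: "inj_on x I"
  proof (rule inj_onI, rule ccontr)
    fix i j assume ij: "i \<in> I" "j \<in> I" "x i = x j" "i \<noteq> j"
    define c where "c = (\<lambda>k. if k = i then 1 else if k = j then -1 else (0::int))"
    have "int_lincomb G x c I = int_lincomb G x c {i, j}"
      using fin x ij by (intro int_lincomb_extend[symmetric]) (auto simp: c_def)
    also have "\<dots> = \<one>"
      using ij x by (subst int_lincomb_insert) (auto simp: int_lincomb_def c_def int_pow_neg)
    finally show False using ind[of c i] ij by (simp add: c_def)
  qed
  have "int_independent G (x ` I)"
    unfolding int_independent_def
  proof (intro conjI allI impI ballI)
    fix c :: "_ \<Rightarrow> int" and y
    assume c: "finprod G (\<lambda>x. x [^] c x) (x ` I) = \<one>" and "y \<in> x ` I"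
    then obtain i where i: "i \<in> I" "y = x i" by auto
    have "finprod G (\<lambda>x. x [^] c x) (x ` I) = int_lincomb G x (c \<circ> x) I"
      unfolding int_lincomb_def o_def using x inj by (intro finprod_reindex) auto
    then show "c y = 0" using c ind[of "c \<circ> x" i] i by simp
  qed (use fin x in auto)
  then have "enat (card (x ` I)) \<le> abelian_rank G"
    unfolding abelian_rank_def by (intro SUP_upper) auto
  then show ?thesis using inj by (simp add: card_image)
qed

end

lemma hom_int_lincomb:
  assumes G: "comm_group G" and H: "comm_group H" and h: "h \<in> hom G H"
    and I: "finite I" "x ` I \<subseteq> carrier G"
  shows "h (int_lincomb G x c I) = int_lincomb H (h \<circ> x) c I"
proof -
  interpret G: comm_group G by fact
  interpret H: comm_group H by fact
  have hcl: "h y \<in> carrier H" if "y \<in> carrier G" for y using h that by (rule hom_in_carrier)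
  show ?thesis using I
  proof (induction I rule: finite_induct)
    case empty
    then show ?case using hom_one[OF h G.group_axioms H.group_axioms] by (simp add: int_lincomb_def)
  next
    case (insert i I)
    have "x ` I \<subseteq> carrier G" "x i \<in> carrier G" using insert.prems by auto
    then show ?case
      using insert hom_mult[OF h] hcl hom_int_pow[OF h _ G.group_axioms H.group_axioms]
      by (simp add: G.int_lincomb_insert H.int_lincomb_insert G.int_lincomb_closed image_subset_iff)
  qed
qed

text \<open>Rank is subadditive along an exact sequence \<open>A\<close>, \<open>B\<close>, \<open>C\<close>. Given independent elements \<open>S\<close>
of \<open>B\<close>, choose a maximal \<open>T \<subseteq> S\<close> whose image in \<open>C\<close> is independent. For every other \<open>s\<close> some
combination \<open>b s\<close> of \<open>T\<close> and \<open>s\<close>, with nonzero coefficient at \<open>s\<close>, dies in \<open>C\<close> and therefore comes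
from an element \<open>a s\<close> of \<open>A\<close>. The \<open>a s\<close> are independent, because in a combination of the \<open>b s\<close> the
coefficient at \<open>s\<close> receives a contribution from \<open>b s\<close> only.\<close>

lemma abelian_rank_exact:
  assumes A: "comm_group A" and B: "comm_group B" and C: "comm_group C"
    and f: "f \<in> hom A B" and g: "g \<in> hom B C" and exact: "kernel B C g \<subseteq> f ` carrier A"
  shows "abelian_rank B \<le> abelian_rank A + abelian_rank C"
  unfolding abelian_rank_def[of B]
proof (rule SUP_least)
  interpret A: comm_group A by fact
  interpret B: comm_group B by fact
  interpret C: comm_group C by fact
  fix S assume "S \<in> {S. int_independent B S}"
  then have S: "finite S" "S \<subseteq> carrier B"
    and ind: "\<And>c i. int_lincomb B (\<lambda>i. i) c S = \<one>\<^bsub>B\<^esub> \<Longrightarrow> i \<in> S \<Longrightarrow> c i = 0"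
    by (auto simp: int_independent_def int_lincomb_def)
  have gcl: "g y \<in> carrier C" if "y \<in> carrier B" for y using g that by (rule hom_in_carrier)
  define \<T> where "\<T> = {T. T \<subseteq> S \<and> int_independent_family C g T}"
  have "finite \<T>" using S(1) by (simp add: \<T>_def)
  moreover have "\<T> \<noteq> {}"
    by (auto simp: \<T>_def int_independent_family_def intro!: exI[of _ "{}"])
  ultimately obtain T where "T \<in> \<T>" and max: "\<And>U. U \<in> \<T> \<Longrightarrow> T \<subseteq> U \<Longrightarrow> T = U"
    using finite_has_maximal[of \<T>] by metis
  then have T: "T \<subseteq> S" "int_independent_family C g T" by (auto simp: \<T>_def)
  have finT: "finite T" using T S finite_subset by blast
  have "\<exists>c. int_lincomb C g c (insert s T) = \<one>\<^bsub>C\<^esub> \<and> c s \<noteq> 0" if s: "s \<in> S - T" for s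
  proof -
    have "\<not> int_independent_family C g (insert s T)"
    proof
      assume "int_independent_family C g (insert s T)"
      then have "insert s T \<in> \<T>" using s T by (auto simp: \<T>_def)
      from max[OF this] s show False by auto
    qed
    moreover have "finite (insert s T)" "g ` insert s T \<subseteq> carrier C" using finT S T s gcl by auto
    ultimately obtain c i where c: "int_lincomb C g c (insert s T) = \<one>\<^bsub>C\<^esub>" "i \<in> insert s T" "c i \<noteq> 0"
      unfolding int_independent_family_def by auto
    have "c s \<noteq> 0"
    proof
      assume "c s = 0"
      then have "int_lincomb C g c T = \<one>\<^bsub>C\<^esub>"
        using c(1) s finT S T gcl
        by (subst C.int_lincomb_extend[of "insert s T"]) auto
      then show False
        using T(2) c \<open>c s = 0\<close> unfolding int_independent_family_def by (metis insertE)
    qed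
    then show ?thesis using c by blast
  qed
  then obtain c0 where c0: "\<And>s. s \<in> S - T \<Longrightarrow> int_lincomb C g (c0 s) (insert s T) = \<one>\<^bsub>C\<^esub>"
      "\<And>s. s \<in> S - T \<Longrightarrow> c0 s s \<noteq> 0"
    by metis
  \<comment> \<open>Extending the coefficients by zero lets all the relations be written over the whole of \<open>S\<close>.\<close>
  define c where "c = (\<lambda>s i. if i \<in> insert s T then c0 s i else 0)"
  define b where "b = (\<lambda>s. int_lincomb B (\<lambda>i. i) (c s) S)"
  have "b s \<in> f ` carrier A" if s: "s \<in> S - T" for s
  proof -
    have "g (b s) = int_lincomb C (g \<circ> (\<lambda>i. i)) (c s) S"
      unfolding b_def by (rule hom_int_lincomb[OF B C g]) (use S in auto)
    also have "\<dots> = int_lincomb C g (c s) S" by (simp add: o_def)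
    also have "\<dots> = int_lincomb C g (c s) (insert s T)"
      using S s T gcl by (intro C.int_lincomb_extend[symmetric]) (auto simp: c_def)
    also have "\<dots> = int_lincomb C g (c0 s) (insert s T)"
      using S s T gcl by (intro C.int_lincomb_cong) (auto simp: c_def)
    finally have "g (b s) = \<one>\<^bsub>C\<^esub>" using c0 s by simp
    moreover have "b s \<in> carrier B"
      unfolding b_def by (rule B.int_lincomb_closed) (use S in auto)
    ultimately show ?thesis using exact by (auto simp: kernel_def)
  qed
  then have inv: "inv_into (carrier A) f (b s) \<in> carrier A" "f (inv_into (carrier A) f (b s)) = b s"
    if "s \<in> S - T" for s
    using that by (auto intro: inv_into_into f_inv_into_f)
  define a where "a = (\<lambda>s. inv_into (carrier A) f (b s))"
  have a: "a s \<in> carrier A" "f (a s) = b s" if "s \<in> S - T" for s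
    using inv[OF that] by (simp_all add: a_def)
  have bcl: "b s \<in> carrier B" for s
    unfolding b_def by (rule B.int_lincomb_closed) (use S in auto)
  have "int_independent_family A a (S - T)"
    unfolding int_independent_family_def
  proof (intro conjI allI impI ballI)
    fix d i assume d: "int_lincomb A a d (S - T) = \<one>\<^bsub>A\<^esub>" and i: "i \<in> S - T"
    have "\<one>\<^bsub>B\<^esub> = f (int_lincomb A a d (S - T))"
      using d hom_one[OF f A.group_axioms B.group_axioms] by simp
    also have "\<dots> = int_lincomb B (f \<circ> a) d (S - T)"
      by (rule hom_int_lincomb[OF A B f]) (use S a in auto)
    also have "\<dots> = int_lincomb B b d (S - T)"
      unfolding int_lincomb_def using bcl a by (intro B.finprod_cong') auto
    also have "\<dots> = int_lincomb B (\<lambda>i. i) (\<lambda>i. \<Sum>s\<in>S - T. c s i * d s) S"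
      unfolding b_def by (rule B.int_lincomb_int_lincomb) (use S in auto)
    finally have "(\<Sum>s\<in>S - T. c s i * d s) = 0"
      using ind[of "\<lambda>i. \<Sum>s\<in>S - T. c s i * d s" i] i by simp
    moreover have "(\<Sum>s\<in>S - T. c s i * d s) = (\<Sum>s\<in>{i}. c s i * d s)"
      using S i by (intro sum.mono_neutral_right) (auto simp: c_def)
    ultimately show "d i = 0" using c0(2)[OF i] by (simp add: c_def)
  qed (use S a in auto)
  then have "enat (card (S - T)) \<le> abelian_rank A" by (rule A.card_le_abelian_rank)
  moreover have "enat (card T) \<le> abelian_rank C" using T(2) by (rule C.card_le_abelian_rank)
  moreover have "card S = card (S - T) + card T"
    using S T finT by (simp add: card_Diff_subset card_mono)
  ultimately show "enat (card S) \<le> abelian_rank A + abelian_rank C"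
    by (metis add_mono plus_enat_simps(1))
qed

lemma abelian_rank_trivial:
  assumes "comm_group G" "trivial_group G"
  shows "abelian_rank G = 0"
proof -
  interpret comm_group G by fact
  have empty: "B = {}" if "int_independent G B" for B
  proof (rule ccontr)
    assume "B \<noteq> {}"
    then obtain x where x: "x \<in> B" by auto
    have B: "B \<subseteq> {\<one>\<^bsub>G\<^esub>}" using that assms by (auto simp: int_independent_def trivial_group_def)
    then have "B = {\<one>\<^bsub>G\<^esub>}" using x by auto
    moreover have "finprod G (\<lambda>x. x [^]\<^bsub>G\<^esub> (\<lambda>_. 1::int) x) {\<one>\<^bsub>G\<^esub>} = \<one>\<^bsub>G\<^esub>"
      by (subst finprod_insert) auto
    moreover have "finprod G (\<lambda>x. x [^]\<^bsub>G\<^esub> c x) B = \<one>\<^bsub>G\<^esub> \<Longrightarrow> c x = 0" for c :: "'a \<Rightarrow> int"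
      using that x by (simp add: int_independent_def)
    from this[of "\<lambda>_. 1"] calculation show False by simp
  qed
  have "enat (card B) \<le> 0" if "B \<in> {B. int_independent G B}" for B
    using empty[of B] that by (simp add: zero_enat_def)
  then have "abelian_rank G \<le> 0"
    unfolding abelian_rank_def by (rule SUP_least)
  then show ?thesis by simp
qed

lemma abelian_rank_integer_group: "abelian_rank integer_group \<le> 1"
  unfolding abelian_rank_def
proof (rule SUP_least)
  interpret comm_group integer_group by (rule abelian_integer_group)
  fix B assume "B \<in> {B. int_independent integer_group B}"
  then have B: "finite B" and ind: "\<And>c i. int_lincomb integer_group (\<lambda>i. i) c B = \<one>\<^bsub>integer_group\<^esub> \<Longrightarrow> i \<in> B \<Longrightarrow> c i = 0"
    by (auto simp: int_independent_def int_lincomb_def)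
  have "a = b" if ab: "a \<in> B" "b \<in> B" for a b
  proof (rule ccontr)
    assume "a \<noteq> b"
    have E: "int_lincomb integer_group (\<lambda>i. i) c B = c a * a + c b * b"
      if "\<And>i. i \<notin> {a, b} \<Longrightarrow> c i = 0" for c
    proof -
      have "int_lincomb integer_group (\<lambda>i. i) c B = int_lincomb integer_group (\<lambda>i. i) c {a, b}"
        using B ab that by (intro int_lincomb_extend[symmetric]) auto
      also have "\<dots> = c a * a + c b * b"
        using \<open>a \<noteq> b\<close> by (subst int_lincomb_insert) (auto simp: int_lincomb_def)
      finally show ?thesis .
    qed
    have "a = 0" using ind[of "\<lambda>i. if i = a then b else if i = b then - a else 0" b] E ab \<open>a \<noteq> b\<close> by auto
    moreover have "b = 0" using ind[of "\<lambda>i. if i = a then b else if i = b then - a else 0" a] E ab \<open>a \<noteq> b\<close> by auto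
    ultimately show False using \<open>a \<noteq> b\<close> by simp
  qed
  then have "card B \<le> 1" by (intro card_le_Suc0_iff_eq[THEN iffD2, OF B, folded One_nat_def]) auto
  then show "enat (card B) \<le> 1" by (simp add: one_enat_def)
qed

lemma abelian_rank_iso:
  assumes "comm_group G" "comm_group H" "G \<cong> H"
  shows "abelian_rank G = abelian_rank H"
proof (rule antisym)
  interpret G: comm_group G by fact
  show "abelian_rank G \<le> abelian_rank H" using assms by (rule abelian_rank_le)
  show "abelian_rank H \<le> abelian_rank G"
    using assms(2,1) G.iso_sym[OF assms(3)] by (rule abelian_rank_le)
qed

text \<open>The exact sequence of the pair bounds the rank for \<open>X\<close> by those for \<open>U\<close> and for the pair
\<open>(X, U)\<close>; by excision of the closed set outside \<open>V\<close> the latter pair may be replaced by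
\<open>(V, U \<inter> V)\<close>, to which the exact sequence applies once more.\<close>

lemma homology_rank_mayer_vietoris:
  assumes U: "openin X U" and V: "openin X V" and UV: "U \<union> V = topspace X"
  shows "abelian_rank (homology_group k X)
    \<le> abelian_rank (homology_group k (subtopology X U)) + (abelian_rank (homology_group k (subtopology X V))
      + abelian_rank (homology_group (k - 1) (subtopology X (U \<inter> V))))"
proof -
  have "abelian_rank (homology_group k X) \<le> abelian_rank (homology_group k (subtopology X U))
      + abelian_rank (relative_homology_group k X U)"
    using homology_exactness_axiom_3[of k X U]
    by (intro abelian_rank_exact) (auto simp: abelian_homology_group)
  also have "abelian_rank (relative_homology_group k X U)
      = abelian_rank (relative_homology_group k (subtopology X V) (U \<inter> V))"
  proof -
    have "closedin X (topspace X - V)" using V by (rule closedin_diff[OF closedin_topspace])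
    then have "X closure_of (topspace X - V) \<subseteq> X interior_of U"
      using U UV by (auto simp: closure_of_closedin interior_of_openin)
    moreover have "topspace X - (topspace X - V) = V" "U - (topspace X - V) = U \<inter> V"
      using openin_subset[OF U] openin_subset[OF V] by auto
    ultimately show ?thesis
      using homology_excision_axiom[of X "topspace X - V" U "topspace X" k] openin_subset[OF U]
      by (intro abelian_rank_iso[symmetric]) (auto simp: is_iso_def)
  qed
  also have "\<dots> \<le> abelian_rank (homology_group k (subtopology X V))
      + abelian_rank (homology_group (k - 1) (subtopology (subtopology X V) (U \<inter> V)))"
    using homology_exactness_axiom_1[of k "subtopology X V" "U \<inter> V"]
    by (intro abelian_rank_exact) (auto simp: abelian_homology_group)
  also have "subtopology (subtopology X V) (U \<inter> V) = subtopology X (U \<inter> V)"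
    by (simp add: subtopology_subtopology Int_commute Int_left_commute)
  finally show ?thesis by (simp add: add_left_mono)
qed

definition homology_rank :: "int \<Rightarrow> (real ^ 'd) set \<Rightarrow> enat" where
  "homology_rank k S = abelian_rank (homology_group k (top_of_set S))"

lemma homology_rank_Un:
  assumes "open U" "open V"
  shows "homology_rank k (U \<union> V) \<le> homology_rank k U + (homology_rank k V + homology_rank (k - 1) (U \<inter> V))"
proof -
  let ?X = "top_of_set (U \<union> V)"
  have op: "openin ?X U" "openin ?X V"
    using assms by (auto simp: openin_open)
  have sub: "subtopology ?X W = top_of_set W" if "W \<subseteq> U \<union> V" for W
    using that by (simp add: subtopology_subtopology Int_absorb1)
  have "U \<union> V = topspace ?X" by simp
  note homology_rank_mayer_vietoris[OF op this, of k]
  also have "subtopology ?X U = top_of_set U" by (rule sub) blast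
  also have "subtopology ?X V = top_of_set V" by (rule sub) blast
  also have "subtopology ?X (U \<inter> V) = top_of_set (U \<inter> V)" by (rule sub) blast
  finally show ?thesis unfolding homology_rank_def .
qed

lemma homology_rank_empty: "homology_rank k {} = 0"
  unfolding homology_rank_def by (intro abelian_rank_trivial abelian_homology_group trivial_homology_group_empty) simp

lemma homology_rank_convex_0:
  assumes "convex S" "k \<noteq> 0"
  shows "homology_rank k S = 0"
proof (cases "S = {}")
  case False
  then obtain a where "a \<in> S" by auto
  have "S homotopy_eqv {a}"
    using assms False by (intro homotopy_eqv_contractible_sets convex_imp_contractible) auto
  then have "homology_rank k S = homology_rank k {a}"
    unfolding homology_rank_def
    by (intro abelian_rank_iso abelian_homology_group homotopy_equivalent_space_imp_isomorphic_homology_groups)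
  also have "\<dots> = 0"
    unfolding homology_rank_def using assms by (intro abelian_rank_trivial abelian_homology_group homology_dimension_axiom[of _ a]) auto
  finally show ?thesis .
next
  case True
  then show ?thesis by (simp only: homology_rank_empty)
qed

lemma homology_rank_convex:
  assumes "convex S"
  shows "homology_rank k S \<le> 1"
proof (cases "k = 0 \<and> S \<noteq> {}")
  case True
  have "path_connected_space (top_of_set S)"
    using convex_imp_path_connected[OF assms]
    by (rule path_connected_space_euclidean_subtopology[THEN iffD2])
  moreover have "topspace (top_of_set S) \<noteq> {}" using True by simp
  ultimately have "homology_group 0 (top_of_set S) \<cong> integer_group"
    by (rule isomorphic_integer_zeroth_homology_group)
  then have "homology_rank 0 S = abelian_rank integer_group"
    unfolding homology_rank_def
    by (intro abelian_rank_iso abelian_homology_group abelian_integer_group)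
  then show ?thesis using True abelian_rank_integer_group by simp
next
  case False
  then show ?thesis
    using assms by (cases "S = {}") (simp_all add: homology_rank_empty homology_rank_convex_0)
qed

text \<open>A crude bound, valid in all degrees at once: adding one convex set \<open>C\<close> to a union of \<open>m\<close> of them
contributes the rank for \<open>C\<close> and that for the intersection, which is again a union of \<open>m\<close> convex
open sets. Thus the bound \<open>b\<close> satisfies \<open>b (m + 1) = 1 + 2 * b m\<close>.\<close>

lemma homology_rank_Union_convex:
  assumes "finite \<C>" "\<And>C. C \<in> \<C> \<Longrightarrow> open C \<and> convex C"
  shows "homology_rank k (\<Union>\<C>) \<le> enat (2 ^ card \<C> - 1)"
proof -
  have "homology_rank k (\<Union>(C ` I)) \<le> enat (2 ^ card I - 1)"
    if "finite I" "\<And>i. i \<in> I \<Longrightarrow> open (C i) \<and> convex (C i)" for C :: "(real ^ 'd) set \<Rightarrow> (real ^ 'd) set" and I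
    using that
  proof (induction I arbitrary: C k rule: finite_induct)
    case empty
    then show ?case by (simp add: homology_rank_empty zero_enat_def)
  next
    case (insert i I)
    have "homology_rank k (\<Union>(C ` insert i I))
        \<le> homology_rank k (C i) + (homology_rank k (\<Union>(C ` I)) + homology_rank (k - 1) (C i \<inter> \<Union>(C ` I)))"
      using insert.prems by (simp, intro homology_rank_Un) auto
    also have "C i \<inter> \<Union>(C ` I) = \<Union>((\<lambda>j. C i \<inter> C j) ` I)" by auto
    also have "homology_rank k (C i) \<le> enat 1"
      using homology_rank_convex insert.prems by (metis insertI1 one_enat_def)
    also have "homology_rank k (\<Union>(C ` I)) \<le> enat (2 ^ card I - 1)"
      using insert.prems by (intro insert.IH) auto
    also have "homology_rank (k - 1) (\<Union>((\<lambda>j. C i \<inter> C j) ` I)) \<le> enat (2 ^ card I - 1)"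
      using insert.prems by (intro insert.IH) (auto intro: convex_Int)
    also have "enat 1 + (enat (2 ^ card I - 1) + enat (2 ^ card I - 1)) = enat (2 ^ card (insert i I) - 1)"
    proof -
      have "(1::nat) \<le> 2 ^ card I" by simp
      then have "Suc (2 ^ card I - 1 + (2 ^ card I - 1)) = 2 * 2 ^ card I - (1::nat)" by linarith
      then show ?thesis using insert.hyps by simp
    qed
    finally show ?case by (simp add: add_mono)
  qed
  from this[of \<C> "\<lambda>C. C"] show ?thesis using assms by simp
qed

text \<open>When every set of the cover meets at most \<open>m\<close> sets, the intersection met at each step of
the previous argument is a union of at most \<open>m\<close> convex sets. Its contribution is then bounded by a
constant, and the rank grows at most linearly in the number of sets.\<close>

lemma homology_rank_sparse_convex_cover:
  assumes "finite \<C>" "\<And>C. C \<in> \<C> \<Longrightarrow> open C \<and> convex C"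
    and "\<And>C. C \<in> \<C> \<Longrightarrow> card {B \<in> \<C>. B \<inter> C \<noteq> {}} \<le> m"
  shows "homology_rank k (\<Union>\<C>) \<le> enat (2 ^ m * card \<C>)"
  using assms
proof (induction \<C> rule: finite_induct)
  case empty
  then show ?case by (simp add: homology_rank_empty zero_enat_def)
next
  case (insert C \<C>)
  let ?N = "{B \<in> \<C>. B \<inter> C \<noteq> {}}"
  have mono: "card {B \<in> \<C>. B \<inter> D \<noteq> {}} \<le> m" if "D \<in> insert C \<C>" for D
  proof -
    have "card {B \<in> \<C>. B \<inter> D \<noteq> {}} \<le> card {B \<in> insert C \<C>. B \<inter> D \<noteq> {}}"
      using insert.hyps by (intro card_mono) auto
    also have "\<dots> \<le> m" using insert.prems(2) that by blast
    finally show ?thesis .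
  qed
  have "homology_rank (k - 1) (\<Union>((\<lambda>B. B \<inter> C) ` ?N)) \<le> enat (2 ^ card ((\<lambda>B. B \<inter> C) ` ?N) - 1)"
    using insert by (intro homology_rank_Union_convex) (auto intro: convex_Int)
  also have "\<dots> \<le> enat (2 ^ m - 1)"
  proof -
    have "card ((\<lambda>B. B \<inter> C) ` ?N) \<le> m"
      using mono[of C] card_image_le[of ?N "\<lambda>B. B \<inter> C"] insert.hyps by (simp add: order_trans)
    then show ?thesis by (simp add: diff_le_mono power_increasing)
  qed
  also have "\<Union>((\<lambda>B. B \<inter> C) ` ?N) = C \<inter> \<Union>\<C>" by auto
  finally have N: "homology_rank (k - 1) (C \<inter> \<Union>\<C>) \<le> enat (2 ^ m - 1)" .
  have "homology_rank k (\<Union>(insert C \<C>))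
      \<le> homology_rank k C + (homology_rank k (\<Union>\<C>) + homology_rank (k - 1) (C \<inter> \<Union>\<C>))"
    using insert.prems by (simp, intro homology_rank_Un) auto
  also have "\<dots> \<le> enat 1 + (enat (2 ^ m * card \<C>) + enat (2 ^ m - 1))"
    using insert homology_rank_convex[of C k] mono N
    by (intro add_mono) (auto simp: one_enat_def)
  also have "\<dots> = enat (2 ^ m * card (insert C \<C>))"
  proof -
    have "(1::nat) \<le> 2 ^ m" by simp
    then show ?thesis using insert.hyps by simp
  qed
  finally show ?case .
qed

section \<open>Cubical sets and the lattice\<close>

definition adj :: "int ^ 'd \<Rightarrow> int ^ 'd \<Rightarrow> bool" where
  "adj z w \<longleftrightarrow> (\<exists>i. w = z + axis i 1 \<or> z = w + axis i 1)"

text \<open>The lattice positions of the unit cubes through \<open>x\<close>; there are several when \<open>x\<close> lies on a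
face.\<close>

definition incident :: "real ^ 'd \<Rightarrow> (int ^ 'd) set" where
  "incident x = {z. \<forall>i. of_int (z $ i) \<le> x $ i \<and> x $ i \<le> of_int (z $ i) + 1}"

definition corner :: "real ^ 'd \<Rightarrow> int ^ 'd" where
  "corner x = (\<chi> i. \<lfloor>x $ i\<rfloor>)"

definition center :: "int ^ 'd \<Rightarrow> real ^ 'd" where
  "center z = (\<chi> i. of_int (z $ i) + 1/2)"

lemma adj_sym: "adj z w \<longleftrightarrow> adj w z"
  by (auto simp: adj_def)

lemma adj_translate: "adj (v + x) (v + y) \<longleftrightarrow> adj x y"
  by (simp add: adj_def add.assoc)

lemma mem_cube_iff: "x \<in> cube 1 z \<longleftrightarrow> z \<in> incident x"
  by (simp add: cube_def incident_def mem_box_cart)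

lemma corner_in_incident: "corner x \<in> incident x"
  by (auto simp: incident_def corner_def)

lemma of_int_less_add_one: "real_of_int a < of_int b + 1 \<longleftrightarrow> a \<le> b"
  by (metis of_int_1 of_int_add of_int_less_iff zless_add1_eq order_le_less)

text \<open>The points all of whose cubes pass through \<open>x\<close> form the open star of the cell containing
\<open>x\<close>, which is an open box.\<close>

lemma incident_subset_iff:
  "incident y \<subseteq> incident x \<longleftrightarrow>
     y \<in> box (\<chi> i. of_int \<lceil>x $ i\<rceil> - 1) (\<chi> i. of_int \<lfloor>x $ i\<rfloor> + 1)"
proof
  assume sub: "incident y \<subseteq> incident x"
  have "(\<chi> i. \<lceil>y $ i\<rceil> - 1) \<in> incident y"
    by (simp add: incident_def)
  then have up: "(\<chi> i. \<lceil>y $ i\<rceil> - 1) \<in> incident x" and lo: "corner y \<in> incident x"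
    using sub corner_in_incident by auto
  show "y \<in> box (\<chi> i. of_int \<lceil>x $ i\<rceil> - 1) (\<chi> i. of_int \<lfloor>x $ i\<rfloor> + 1)"
    unfolding mem_box_cart
  proof (intro allI conjI)
    fix i
    have "x $ i \<le> of_int \<lceil>y $ i\<rceil>" using up by (simp add: incident_def)
    then have "\<lceil>x $ i\<rceil> \<le> \<lceil>y $ i\<rceil>" by (rule ceiling_le)
    then show "(\<chi> i. of_int \<lceil>x $ i\<rceil> - 1) $ i < y $ i" by simp linarith
    have "of_int \<lfloor>y $ i\<rfloor> \<le> x $ i" using lo by (simp add: incident_def corner_def)
    then have "\<lfloor>y $ i\<rfloor> \<le> \<lfloor>x $ i\<rfloor>" by (simp add: le_floor_iff)
    then show "y $ i < (\<chi> i. of_int \<lfloor>x $ i\<rfloor> + 1) $ i" by simp linarith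
  qed
next
  assume y: "y \<in> box (\<chi> i. of_int \<lceil>x $ i\<rceil> - 1) (\<chi> i. of_int \<lfloor>x $ i\<rfloor> + 1)"
  show "incident y \<subseteq> incident x"
  proof
    fix z assume z: "z \<in> incident y"
    have "of_int (z $ i) \<le> x $ i \<and> x $ i \<le> of_int (z $ i) + 1" for i
    proof -
      have "of_int \<lceil>x $ i\<rceil> - 1 < y $ i" "y $ i < of_int \<lfloor>x $ i\<rfloor> + 1"
        using y by (auto simp: mem_box_cart)
      moreover have "of_int (z $ i) \<le> y $ i" "y $ i \<le> of_int (z $ i) + 1"
        using z by (auto simp: incident_def)
      ultimately have "real_of_int (z $ i) < of_int \<lfloor>x $ i\<rfloor> + 1"
        "real_of_int \<lceil>x $ i\<rceil> < of_int (z $ i + 1) + 1" by auto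
      then have "z $ i \<le> \<lfloor>x $ i\<rfloor>" "\<lceil>x $ i\<rceil> \<le> z $ i + 1"
        unfolding of_int_less_add_one .
      then show ?thesis by (simp add: le_floor_iff ceiling_le_iff)
    qed
    then show "z \<in> incident x" by (simp add: incident_def)
  qed
qed

lemma incident_center: "incident (center z) = {z}"
proof -
  have "of_int (w $ i) \<le> center z $ i \<and> center z $ i \<le> of_int (w $ i) + 1 \<longleftrightarrow> w $ i = z $ i" for w i
    using of_int_less_add_one[of "w $ i" "z $ i"] of_int_less_add_one[of "z $ i" "w $ i"]
    by (auto simp: center_def)
  then show ?thesis by (auto simp: incident_def vec_eq_iff)
qed

lemma corner_center: "corner (center z) = z"
  using corner_in_incident[of "center z"] incident_center by auto

lemma interior_cube_incident:
  assumes "x \<in> interior (cube 1 z)"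
  shows "incident x = {z}"
proof -
  have x: "of_int (z $ i) < x $ i \<and> x $ i < of_int (z $ i) + 1" for i
    using assms by (auto simp: cube_def mem_box_cart)
  have "w $ i = z $ i" if "w \<in> incident x" for w i
  proof -
    have "of_int (w $ i) \<le> x $ i" "x $ i \<le> of_int (w $ i) + 1" using that by (auto simp: incident_def)
    then show ?thesis
      using x[of i] of_int_less_add_one[of "w $ i" "z $ i"] of_int_less_add_one[of "z $ i" "w $ i"] by linarith
  qed
  then have "w = z" if "w \<in> incident x" for w using that by (simp add: vec_eq_iff)
  moreover have "z \<in> incident x" using x by (auto simp: incident_def less_imp_le)
  ultimately show ?thesis by blast
qed

lemma cube_closure_interior: "cube 1 z = closure (interior (cube 1 z))"
proof -
  have "center z \<in> box (\<chi> i. real_of_int (z $ i)) (\<chi> i. real_of_int (z $ i) + 1)"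
    by (simp add: center_def mem_box_cart)
  then have "box (\<chi> i. real_of_int (z $ i)) (\<chi> i. real_of_int (z $ i) + 1) \<noteq> {}" by blast
  then show ?thesis by (simp add: cube_def closure_box)
qed

text \<open>If \<open>x\<close> is an interior point of the union and lies in the cube at \<open>z\<close>, then some points near
\<open>x\<close> are interior to that cube and so are covered by no other cube; hence \<open>z\<close> is in \<open>Z\<close>.
Conversely the open star of \<open>x\<close> is a neighbourhood of \<open>x\<close> inside the union.\<close>

lemma cubical_set_eq: "cubical_set Z = {x. incident x \<subseteq> Z}"
proof (intro equalityI subsetI; unfold mem_Collect_eq)
  fix x assume x: "x \<in> cubical_set Z"
  show "incident x \<subseteq> Z"
  proof
  fix z assume z: "z \<in> incident x"
  then have "x \<in> closure (interior (cube 1 z))"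
    using mem_cube_iff[of x z] cube_closure_interior[of z] by metis
  then obtain y where y: "y \<in> cubical_set Z" "y \<in> interior (cube 1 z)"
    using x open_Int_closure_eq_empty[of "cubical_set Z" "interior (cube 1 z)"]
    by (auto simp: cubical_set_def)
  have "y \<in> (\<Union>z\<in>Z. cube 1 z)" using y interior_subset by (auto simp: cubical_set_def)
  then show "z \<in> Z" using interior_cube_incident[OF y(2)]
    by (auto simp: mem_cube_iff simp del: One_nat_def)
  qed
next
  fix x assume x: "incident x \<subseteq> Z"
  show "x \<in> cubical_set Z"
    unfolding cubical_set_def
  proof (rule interiorI)
    show "open {y. incident y \<subseteq> incident x}" by (simp add: incident_subset_iff open_box)
    show "{y. incident y \<subseteq> incident x} \<subseteq> (\<Union>z\<in>Z. cube 1 z)"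
    proof
      fix y assume "y \<in> {y. incident y \<subseteq> incident x}"
      then have "corner y \<in> Z" "y \<in> cube 1 (corner y)"
        using x corner_in_incident[of y] by (auto simp: mem_cube_iff simp del: One_nat_def)
      then show "y \<in> (\<Union>z\<in>Z. cube 1 z)" by blast
    qed
  qed auto
qed

lemma open_cubical_set: "open (cubical_set Z)"
  by (simp add: cubical_set_def)

lemma cubical_set_mono: "A \<subseteq> B \<Longrightarrow> cubical_set A \<subseteq> cubical_set B"
  by (auto simp: cubical_set_eq)

lemma convex_cubical_set_incident: "convex (cubical_set (incident x))"
  by (simp add: cubical_set_eq incident_subset_iff convex_box)

lemma center_in_cubical_set: "center z \<in> cubical_set Z \<longleftrightarrow> z \<in> Z"
  by (simp add: cubical_set_eq incident_center)

lemma cubical_set_eq_iff: "cubical_set A = cubical_set B \<longleftrightarrow> A = B"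
  by (metis center_in_cubical_set subsetI subset_antisym)

lemma interior_cube: "interior (cube 1 z) = cubical_set {z}"
  by (simp add: cubical_set_def)

lemma unit_cubes_in_cubical_set: "unit_cubes_in (cubical_set K) = K"
proof -
  have "cubical_set {z} \<subseteq> cubical_set K \<longleftrightarrow> z \<in> K" for z
    using center_in_cubical_set[of z "{z}"] center_in_cubical_set[of z K] cubical_set_mono[of "{z}" K]
    by blast
  then show ?thesis by (simp add: unit_cubes_in_def interior_cube del: One_nat_def)
qed

lemma corner_in: "x \<in> cubical_set Z \<Longrightarrow> corner x \<in> Z"
  using corner_in_incident by (auto simp: cubical_set_eq)

section \<open>Betti numbers of cubical sets\<close>

definition around :: "int ^ 'd \<Rightarrow> (int ^ 'd) set" where
  "around z = {w. \<forall>i. \<bar>w $ i - z $ i\<bar> \<le> 1}"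

lemma around_eq: "around z = (+) z ` around 0"
proof -
  have "w \<in> (+) z ` around 0" if "w \<in> around z" for w
    using that by (intro image_eqI[of _ _ "w - z"]) (auto simp: around_def)
  then show ?thesis by (auto simp: around_def)
qed

lemma finite_int_box: "finite {w :: int ^ 'd::finite. \<forall>i. a i \<le> w $ i \<and> w $ i \<le> b i}"
proof -
  have "{w :: int ^ 'd. \<forall>i. a i \<le> w $ i \<and> w $ i \<le> b i} \<subseteq> vec_lambda ` (PiE UNIV (\<lambda>i. {a i..b i}))"
  proof
    fix w :: "int ^ 'd" assume "w \<in> {w. \<forall>i. a i \<le> w $ i \<and> w $ i \<le> b i}"
    then show "w \<in> vec_lambda ` (PiE UNIV (\<lambda>i. {a i..b i}))"
      by (intro image_eqI[of _ _ "($) w"]) auto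
  qed
  then show ?thesis by (rule finite_subset) (intro finite_imageI finite_PiE; simp)
qed

lemma finite_around: "finite (around (z :: int ^ 'd::finite))"
proof -
  have "around z = {w. \<forall>i. z $ i - 1 \<le> w $ i \<and> w $ i \<le> z $ i + 1}"
    by (auto simp: around_def abs_le_iff algebra_simps)
  then show ?thesis by (simp add: finite_int_box)
qed

lemma card_around: "card (around z) = card (around (0 :: int ^ 'd))" for z :: "int ^ 'd"
  unfolding around_eq[of z] by (rule card_image) simp

lemma incident_subset_around:
  assumes "z \<in> incident x"
  shows "incident x \<subseteq> around z"
proof
  fix w assume "w \<in> incident x"
  with assms have "of_int (z $ i) \<le> x $ i \<and> x $ i \<le> of_int (z $ i) + 1 \<and>
      of_int (w $ i) \<le> x $ i \<and> x $ i \<le> of_int (w $ i) + 1" for i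
    by (auto simp: incident_def)
  then have "real_of_int (w $ i) \<le> of_int (z $ i + 1) \<and> real_of_int (z $ i) \<le> of_int (w $ i + 1)" for i
    by (metis of_int_1 of_int_add order_trans)
  then have "\<bar>w $ i - z $ i\<bar> \<le> 1" for i
    unfolding of_int_le_iff by (smt (verit))
  then show "w \<in> around z" by (simp add: around_def)
qed

lemma card_incident_containing:
  fixes z :: "int ^ 'd::finite"
  shows "finite {A \<in> range incident. z \<in> A}"
    "card {A \<in> range incident. z \<in> A} \<le> 2 ^ card (around (0 :: int ^ 'd))"
proof -
  have sub: "{A \<in> range incident. z \<in> A} \<subseteq> Pow (around z)"
    using incident_subset_around by auto
  show "finite {A \<in> range incident. z \<in> A}"
    using finite_around by (intro finite_subset[OF sub]) simp
  show "card {A \<in> range incident. z \<in> A} \<le> 2 ^ card (around (0 :: int ^ 'd))"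
  proof -
    have "card {A \<in> range incident. z \<in> A} \<le> card (Pow (around z))"
      by (rule card_mono[OF _ sub]) (simp add: finite_around)
    also have "\<dots> = 2 ^ card (around z)" by (rule card_Pow[OF finite_around])
    also have "\<dots> = 2 ^ card (around (0 :: int ^ 'd))" by (subst card_around) (rule refl)
    finally show ?thesis .
  qed
qed

lemma card_incident_meeting:
  fixes F :: "(int ^ 'd::finite) set"
  assumes "finite F"
  shows "finite {A \<in> range incident. A \<inter> F \<noteq> {}}"
    "card {A \<in> range incident. A \<inter> F \<noteq> {}} \<le> card F * 2 ^ card (around (0 :: int ^ 'd))"
proof -
  have eq: "{A \<in> range incident. A \<inter> F \<noteq> {}} = (\<Union>z\<in>F. {A \<in> range incident. z \<in> A})" by auto
  show "finite {A \<in> range incident. A \<inter> F \<noteq> {}}"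
    unfolding eq using assms card_incident_containing(1) by blast
  have "card (\<Union>z\<in>F. {A \<in> range incident. z \<in> A}) \<le> (\<Sum>z\<in>F. card {A \<in> range incident. z \<in> A})"
    using assms by (rule card_UN_le)
  also have "\<dots> \<le> card F * 2 ^ card (around (0 :: int ^ 'd))"
    using sum_bounded_above[of F "\<lambda>z. card {A \<in> range incident. z \<in> A}", OF card_incident_containing(2)]
    by simp
  finally show "card {A \<in> range incident. A \<inter> F \<noteq> {}} \<le> card F * 2 ^ card (around (0 :: int ^ 'd))"
    unfolding eq .
qed

text \<open>The cubical set of \<open>F\<close> is covered by the open stars of its cells, that is, by the cubical
sets of those sets \<open>incident x\<close> that are contained in \<open>F\<close>. A site belongs to boundedly many sets
\<open>incident x\<close>, as these lie in the block around the site; so the cover has at most a constant times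
\<open>card F\<close> members, and each member meets boundedly many others.\<close>

lemma betti_le_card:
  obtains D :: nat where "D > 0"
    "\<And>k (F :: (int ^ 'd::finite) set). finite F \<Longrightarrow> betti k (cubical_set F) \<le> enat (D * card F)"
proof
  let ?K = "card (around (0 :: int ^ 'd))"
  \<comment> \<open>At most \<open>2 ^ ?K\<close> stars belong to a site, and a star involves at most \<open>?K\<close> sites.\<close>
  let ?m = "?K * 2 ^ ?K"
  show "2 ^ ?m * 2 ^ ?K > (0::nat)" by simp
  fix k and F :: "(int ^ 'd) set" assume F: "finite F"
  define \<A> where "\<A> = {A \<in> range incident. A \<subseteq> F}"
  have sub: "\<A> \<subseteq> {A \<in> range incident. A \<inter> F \<noteq> {}}"
    using corner_in_incident by (auto simp: \<A>_def)
  have fin: "finite \<A>" using sub card_incident_meeting(1)[OF F] by (rule finite_subset)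
  have "cubical_set F = \<Union>(cubical_set ` \<A>)"
    by (auto simp: cubical_set_eq \<A>_def)
  also have "homology_rank (int k) (\<Union>(cubical_set ` \<A>)) \<le> enat (2 ^ ?m * card (cubical_set ` \<A>))"
  proof (rule homology_rank_sparse_convex_cover)
    fix C assume "C \<in> cubical_set ` \<A>"
    then obtain x where C: "C = cubical_set (incident x)" by (auto simp: \<A>_def)
    show "open C \<and> convex C" using C open_cubical_set convex_cubical_set_incident by auto
    have "{B \<in> cubical_set ` \<A>. B \<inter> C \<noteq> {}} \<subseteq> cubical_set ` {A \<in> range incident. A \<inter> incident x \<noteq> {}}"
    proof
      fix B assume "B \<in> {B \<in> cubical_set ` \<A>. B \<inter> C \<noteq> {}}"
      then obtain A y where A: "A \<in> \<A>" "B = cubical_set A" "y \<in> B" "y \<in> C" by blast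
      then have "corner y \<in> A \<inter> incident x" using C corner_in by blast
      then show "B \<in> cubical_set ` {A \<in> range incident. A \<inter> incident x \<noteq> {}}"
        using A by (auto simp: \<A>_def)
    qed
    moreover have fx: "finite (incident x)"
      using incident_subset_around[OF corner_in_incident] finite_around finite_subset by blast
    ultimately have "card {B \<in> cubical_set ` \<A>. B \<inter> C \<noteq> {}} \<le> card {A \<in> range incident. A \<inter> incident x \<noteq> {}}"
      using card_mono[OF finite_imageI[OF card_incident_meeting(1)[OF fx], of cubical_set]]
        card_image_le[OF card_incident_meeting(1)[OF fx], of cubical_set]
      by (meson order_trans)
    also have "\<dots> \<le> card (incident x) * 2 ^ ?K" using fx by (rule card_incident_meeting)
    also have "\<dots> \<le> ?m"
    proof (rule mult_right_mono)
      show "card (incident x) \<le> ?K"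
        using card_mono[OF finite_around incident_subset_around[OF corner_in_incident[of x]]]
          card_around[of "corner x"] by simp
    qed simp
    finally show "card {B \<in> cubical_set ` \<A>. B \<inter> C \<noteq> {}} \<le> ?m" .
  qed (use fin in auto)
  also have "\<dots> \<le> enat (2 ^ ?m * (card F * 2 ^ ?K))"
  proof -
    have "card (cubical_set ` \<A>) \<le> card F * 2 ^ ?K"
      using card_image_le[OF fin, of cubical_set] card_mono[OF card_incident_meeting(1)[OF F] sub]
        card_incident_meeting(2)[OF F] by (meson order_trans)
    then show ?thesis by (metis enat_ord_simps(1) mult_le_mono2)
  qed
  finally show "betti k (cubical_set F) \<le> enat (2 ^ ?m * 2 ^ ?K * card F)"
    unfolding betti_def homology_rank_def by (simp only: mult_ac)
qed

lemma betti_cube: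
  assumes "k > 0"
  shows "betti k (cubical_set {z}) = 0"
  using homology_rank_convex_0[OF convex_cubical_set_incident[of "center z"], of "int k"] assms
  unfolding betti_def homology_rank_def incident_center by simp

section \<open>Components are lattice clusters\<close>

definition clusters :: "(int ^ 'd) set \<Rightarrow> (int ^ 'd) set set" where
  "clusters Z = (\<lambda>z. cluster adj {z} Z) ` Z"

text \<open>The cubes through a point form a box of side at most two in the lattice, and changing one
coordinate at a time stays inside it.\<close>

lemma incident_subset_cluster:
  assumes "z \<in> incident x"
  shows "incident x \<subseteq> cluster adj {z} (incident x)"
proof
  fix w assume "w \<in> incident x"
  then show "w \<in> cluster adj {z} (incident x)"
  proof (induction "card {i. w $ i \<noteq> z $ i}" arbitrary: w)
    case 0
    then have "w = z" by (simp add: vec_eq_iff)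
    then show ?case using cluster_self by metis
  next
    case (Suc m)
    then obtain i where i: "w $ i \<noteq> z $ i" by (metis (mono_tags) card.empty empty_Collect_eq nat.distinct(1))
    \<comment> \<open>Changing one coordinate of \<open>w\<close> towards \<open>z\<close>.\<close>
    define v where "v = (\<chi> j. if j = i then z $ i else w $ j)"
    have v: "v \<in> incident x" using Suc.prems assms by (auto simp: v_def incident_def)
    have "{i. w $ i \<noteq> z $ i} = insert i {i. v $ i \<noteq> z $ i}" using i by (auto simp: v_def)
    moreover have "i \<notin> {i. v $ i \<noteq> z $ i}" by (simp add: v_def)
    ultimately have "m = card {i. v $ i \<noteq> z $ i}" using Suc.hyps(2) by simp
    then have IH: "v \<in> cluster adj {z} (incident x)" using Suc.hyps(1) v by blast
    have "\<bar>w $ i - z $ i\<bar> \<le> 1"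
      using incident_subset_around[OF assms] Suc.prems by (auto simp: around_def)
    then consider "w $ i = z $ i + 1" | "z $ i = w $ i + 1" using i by linarith
    then have "adj v w"
    proof cases
      case 1
      then have "w = v + axis i 1" by (auto simp: v_def vec_eq_iff axis_def)
      then show ?thesis by (auto simp: adj_def)
    next
      case 2
      then have "v = w + axis i 1" by (auto simp: v_def vec_eq_iff axis_def)
      then show ?thesis by (auto simp: adj_def)
    qed
    then show ?case using IH Suc.prems cluster_step by metis
  qed
qed

lemma incident_face:
  "incident (center z + axis i (1/2)) = {z, z + axis i 1}"
proof -
  have mid: "of_int a \<le> real_of_int b + 1/2 \<longleftrightarrow> a \<le> b" "real_of_int b + 1/2 \<le> of_int a + 1 \<longleftrightarrow> b \<le> a" for a b
    using of_int_less_add_one[of a b] of_int_less_add_one[of b a] by linarith+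
  have "v \<in> incident (center z + axis i (1/2)) \<longleftrightarrow>
      (\<forall>j. if j = i then v $ j = z $ j \<or> v $ j = z $ j + 1 else v $ j = z $ j)" for v
  proof -
    have "of_int (v $ j) \<le> (center z + axis i (1/2)) $ j \<and> (center z + axis i (1/2)) $ j \<le> of_int (v $ j) + 1
        \<longleftrightarrow> (if j = i then v $ j = z $ j \<or> v $ j = z $ j + 1 else v $ j = z $ j)" for j
    proof (cases "j = i")
      case True
      have "of_int (v $ j) \<le> real_of_int (z $ j) + 1 \<longleftrightarrow> v $ j \<le> z $ j + 1" by linarith
      then show ?thesis using True by (auto simp: center_def axis_def)
    next
      case False
      then show ?thesis using mid by (auto simp: center_def axis_def)
    qed
    then show ?thesis by (simp add: incident_def)
  qed
  then have "v \<in> incident (center z + axis i (1/2)) \<longleftrightarrow> v = z \<or> v = z + axis i 1" for v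
    by (auto simp: vec_eq_iff axis_def)
  then show ?thesis by blast
qed

lemma adj_incident:
  assumes "adj z w"
  shows "\<exists>x. incident x = {z, w}"
  using assms incident_face[of z] incident_face[of w] unfolding adj_def by (metis insert_commute)

text \<open>The open star of the midpoint of a common face joins the centres of two neighbouring cubes,
and the open star of any point of the set joins it to the centre of a cube through it.\<close>

lemma connected_cubical_cluster:
  fixes Z :: "(int ^ 'd::finite) set"
  assumes "z \<in> Z"
  shows "connected (cubical_set (cluster adj {z} Z))"
proof -
  define K where "K = cluster adj {z} Z"
  have star: "connected_component (cubical_set K) x y"
    if "incident u \<subseteq> K" "x \<in> cubical_set (incident u)" "y \<in> cubical_set (incident u)" for u x y
    unfolding connected_component_def
    using that cubical_set_mono[OF that(1)] convex_connected[OF convex_cubical_set_incident[of u]]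
    by (intro exI[of _ "cubical_set (incident u)"] conjI)
  have zK: "z \<in> K" by (simp add: K_def cluster_self)
  have "K \<subseteq> {w \<in> K. connected_component (cubical_set K) (center z) (center w)}"
    unfolding K_def
  proof (rule cluster_least, fold K_def)
    show "{z} \<subseteq> {w \<in> K. connected_component (cubical_set K) (center z) (center w)}"
      using zK by (simp add: connected_component_refl_eq center_in_cubical_set)
    fix v w assume v: "v \<in> {w \<in> K. connected_component (cubical_set K) (center z) (center w)}"
      and vw: "adj v w" and "w \<in> Z"
    then have w: "w \<in> K" unfolding K_def using cluster_step by fastforce
    obtain x where x: "incident x = {v, w}" using adj_incident[OF vw] by blast
    have "connected_component (cubical_set K) (center v) (center w)"
      by (rule star[of x]) (use x v w in \<open>auto simp: center_in_cubical_set\<close>)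
    then show "w \<in> {w \<in> K. connected_component (cubical_set K) (center z) (center w)}"
      using v w connected_component_trans by fastforce
  qed
  moreover have "connected_component (cubical_set K) (center (corner x)) x" if "x \<in> cubical_set K" for x
    by (rule star[of x]) (use that corner_in_incident in \<open>auto simp: center_in_cubical_set cubical_set_eq incident_center\<close>)
  ultimately have "connected_component (cubical_set K) (center z) x" if "x \<in> cubical_set K" for x
    using that corner_in connected_component_trans by (metis (no_types, lifting) mem_Collect_eq subsetD)
  then show ?thesis
    unfolding K_def[symmetric] connected_iff_connected_component
    by (meson connected_component_sym connected_component_trans)
qed

text \<open>For a cluster \<open>K\<close> of \<open>Z\<close>, the cubes of \<open>Z\<close> through a given point are lattice-connected, so
they all belong to \<open>K\<close> or all to \<open>Z - K\<close>. Thus the cubical sets of \<open>K\<close> and of \<open>Z - K\<close> separate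
the cubical set of \<open>Z\<close>, and the connected set of \<open>K\<close> is a component.\<close>

lemma components_cubical_set:
  fixes Z :: "(int ^ 'd::finite) set"
  shows "components (cubical_set Z) = cubical_set ` clusters Z"
proof -
  have eq: "connected_component_set (cubical_set Z) x = cubical_set (cluster adj {corner x} Z)"
    if x: "x \<in> cubical_set Z" for x
  proof -
    define K where "K = cluster adj {corner x} Z"
    have cZ: "corner x \<in> Z" using x by (rule corner_in)
    have KZ: "K \<subseteq> Z" unfolding K_def using cZ by (rule cluster_subset_self)
    have dich: "incident y \<subseteq> K \<or> incident y \<subseteq> Z - K" if "y \<in> cubical_set Z" for y
    proof (cases "incident y \<inter> K = {}")
      case True
      then show ?thesis using that by (auto simp: cubical_set_eq)
    next
      case False
      then obtain v where v: "v \<in> incident y" "v \<in> K" by auto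
      have "incident y \<subseteq> cluster adj {v} (incident y)" using v by (intro incident_subset_cluster)
      also have "\<dots> \<subseteq> cluster adj {v} Z" using that by (intro cluster_mono) (auto simp: cubical_set_eq)
      also have "\<dots> = K" unfolding K_def by (rule cluster_sym) (use adj_sym cZ v K_def in auto)
      finally show ?thesis by simp
    qed
    have xK: "x \<in> cubical_set K"
      using dich[OF x] corner_in_incident[of x] cluster_self[of "corner x" adj Z]
      by (auto simp: cubical_set_eq K_def)
    show ?thesis
      unfolding K_def[symmetric]
    proof
      show "cubical_set K \<subseteq> connected_component_set (cubical_set Z) x"
        using xK cubical_set_mono[OF KZ] connected_cubical_cluster[OF cZ]
        by (intro connected_component_maximal) (auto simp: K_def)
      let ?C = "connected_component_set (cubical_set Z) x"
      have C: "?C \<subseteq> cubical_set Z" by (rule connected_component_subset)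
      have "cubical_set K \<inter> ?C = {} \<or> cubical_set (Z - K) \<inter> ?C = {}"
      proof (rule connectedD)
        show "cubical_set K \<inter> cubical_set (Z - K) \<inter> ?C = {}"
          using corner_in_incident by (auto simp: cubical_set_eq)
        show "?C \<subseteq> cubical_set K \<union> cubical_set (Z - K)"
          using dich C by (auto simp: cubical_set_eq)
      qed (auto simp: open_cubical_set)
      moreover have "x \<in> ?C" using x by (simp add: connected_component_refl_eq)
      ultimately have empty: "cubical_set (Z - K) \<inter> ?C = {}" using xK by blast
      show "?C \<subseteq> cubical_set K"
      proof
        fix y assume y: "y \<in> ?C"
        then have "y \<notin> cubical_set (Z - K)" "y \<in> cubical_set Z" using empty C by blast+
        then show "y \<in> cubical_set K" using dich[of y] by (simp add: cubical_set_eq)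
      qed
    qed
  qed
  have "components (cubical_set Z) = (\<lambda>x. cubical_set (cluster adj {corner x} Z)) ` cubical_set Z"
    unfolding components_def using eq by auto
  also have "\<dots> = cubical_set ` (\<lambda>z. cluster adj {z} Z) ` (corner ` cubical_set Z)"
    by (simp add: image_image)
  also have "corner ` cubical_set Z = Z"
    using corner_in center_in_cubical_set corner_center by (metis image_eqI image_subsetI subsetI subset_antisym)
  finally show ?thesis by (simp add: clusters_def)
qed

lemma origin_cubes:
  fixes Z :: "(int ^ 'd::finite) set"
  shows "unit_cubes_in (origin_component Z) = (if 0 \<in> Z then cluster adj {0} Z else {})"
proof -
  have "interior (cube 1 0) \<subseteq> cubical_set K \<longleftrightarrow> 0 \<in> K" for K :: "(int ^ 'd) set"
    using unit_cubes_in_cubical_set[of K] unfolding unit_cubes_in_def by blast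
  then have "{C \<in> components (cubical_set Z). interior (cube 1 0) \<subseteq> C} = cubical_set ` {K \<in> clusters Z. 0 \<in> K}"
    unfolding components_cubical_set by blast
  also have "{K \<in> clusters Z. 0 \<in> K} = (if 0 \<in> Z then {cluster adj {0} Z} else {})"
  proof (cases "0 \<in> Z")
    case True
    have "cluster adj {z} Z = cluster adj {0} Z" if "z \<in> Z" "0 \<in> cluster adj {z} Z" for z
      using cluster_sym[of adj z Z 0] that adj_sym by blast
    then have "K = cluster adj {0} Z" if "K \<in> clusters Z" "0 \<in> K" for K
      using that unfolding clusters_def by blast
    moreover have "cluster adj {0} Z \<in> clusters Z"
      unfolding clusters_def using True by (rule imageI)
    ultimately have "{K \<in> clusters Z. 0 \<in> K} = {cluster adj {0} Z}"
      using cluster_self[of 0 adj Z] by blast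
    then show ?thesis using True by simp
  next
    case False
    then show ?thesis using cluster_subset_self[of _ Z adj] by (auto simp: clusters_def)
  qed
  finally have "origin_component Z = \<Union>(cubical_set ` (if 0 \<in> Z then {cluster adj {0} Z} else {}))"
    unfolding origin_component_def by simp
  moreover have "unit_cubes_in {} = ({} :: (int ^ 'd) set)"
    using unit_cubes_in_cubical_set[of "{}"] by (simp add: cubical_set_def)
  ultimately show ?thesis by (simp add: unit_cubes_in_cubical_set)
qed

section \<open>Components inside a window\<close>

text \<open>The windowed set is the cubical set of these sites, which reduces it to the results on whole
cubical sets.\<close>

definition confined :: "(int ^ 'd) set \<Rightarrow> (int ^ 'd) set \<Rightarrow> (int ^ 'd) set" where
  "confined W Z = {z \<in> Z. cluster adj {z} Z \<subseteq> W}"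

definition window_cubes :: "nat \<Rightarrow> (int ^ 'd) set" where
  "window_cubes L = {z. cube 1 z \<subseteq> window L}"

lemma cubical_set_subset_window: "cubical_set K \<subseteq> window L \<longleftrightarrow> K \<subseteq> window_cubes L"
proof
  assume "cubical_set K \<subseteq> window L"
  show "K \<subseteq> window_cubes L"
  proof
    fix z assume "z \<in> K"
    then have "interior (cube 1 z) \<subseteq> window L"
      using cubical_set_mono[of "{z}" K] \<open>cubical_set K \<subseteq> window L\<close> unfolding interior_cube by blast
    then have "closure (interior (cube 1 z)) \<subseteq> window L"
      by (rule closure_minimal) (simp add: window_def closed_cbox)
    then show "z \<in> window_cubes L" unfolding cube_closure_interior[symmetric] by (simp add: window_cubes_def)
  qed
next
  assume "K \<subseteq> window_cubes L"
  then have "(\<Union>z\<in>K. cube 1 z) \<subseteq> window L" unfolding window_cubes_def by blast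
  then show "cubical_set K \<subseteq> window L"
    unfolding cubical_set_def using interior_subset by blast
qed

lemma cluster_confined:
  assumes "z \<in> confined W Z"
  shows "cluster adj {z} (confined W Z) = cluster adj {z} Z"
proof
  show "cluster adj {z} (confined W Z) \<subseteq> cluster adj {z} Z"
    by (intro cluster_mono) (auto simp: confined_def)
  have z: "z \<in> Z" "cluster adj {z} Z \<subseteq> W" using assms by (auto simp: confined_def)
  have in_conf: "w \<in> confined W Z" if "w \<in> cluster adj {z} Z" for w
    using that cluster_sym[OF _ z(1) that] z cluster_subset_self[of z Z adj]
    by (auto simp: confined_def adj_sym)
  have "cluster adj {z} Z \<subseteq> cluster adj {z} (confined W Z) \<inter> cluster adj {z} Z"
  proof (rule cluster_least)
    show "{z} \<subseteq> cluster adj {z} (confined W Z) \<inter> cluster adj {z} Z"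
      by (simp add: cluster_self)
    fix x y assume x: "x \<in> cluster adj {z} (confined W Z) \<inter> cluster adj {z} Z" and xy: "adj x y" "y \<in> Z"
    then have y: "y \<in> cluster adj {z} Z" using cluster_step[of x adj "{z}" Z y] by auto
    then show "y \<in> cluster adj {z} (confined W Z) \<inter> cluster adj {z} Z"
      using x xy in_conf[OF y] cluster_step[of x adj "{z}" "confined W Z" y] by auto
  qed
  then show "cluster adj {z} Z \<subseteq> cluster adj {z} (confined W Z)" by blast
qed

lemma clusters_confined: "clusters (confined W Z) = {K \<in> clusters Z. K \<subseteq> W}"
proof -
  have "clusters (confined W Z) = (\<lambda>z. cluster adj {z} Z) ` confined W Z"
    unfolding clusters_def by (rule image_cong[OF refl cluster_confined])
  then show ?thesis by (auto simp: clusters_def confined_def)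
qed

lemma windowed_set_eq:
  fixes Z :: "(int ^ 'd::finite) set"
  shows "windowed_set L Z = cubical_set (confined (window_cubes L) Z)"
proof -
  have "{C \<in> cubical_set ` clusters Z. C \<subseteq> window L} = cubical_set ` {K \<in> clusters Z. K \<subseteq> window_cubes L}"
    using cubical_set_subset_window by blast
  then have "windowed_set L Z = \<Union>(cubical_set ` {K \<in> clusters Z. K \<subseteq> window_cubes L})"
    by (simp only: windowed_set_def components_cubical_set)
  also have "\<dots> = \<Union>(components (cubical_set (confined (window_cubes L) Z)))"
    by (simp add: components_cubical_set clusters_confined)
  finally show ?thesis by (simp add: Union_components)
qed

lemma components_windowed_set:
  fixes Z :: "(int ^ 'd::finite) set"
  shows "components (windowed_set L Z) = cubical_set ` clusters (confined (window_cubes L) Z)"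
  by (simp add: windowed_set_eq components_cubical_set)

lemma finite_window_cubes: "finite (window_cubes L :: (int ^ 'd::finite) set)"
proof -
  have "window_cubes L \<subseteq> {w :: int ^ 'd. \<forall>i. - \<lfloor>real L / 2\<rfloor> \<le> w $ i \<and> w $ i \<le> \<lceil>real L / 2\<rceil>}"
  proof (safe)
    fix w :: "int ^ 'd" and i assume "w \<in> window_cubes L"
    moreover have "(\<chi> i. of_int (w $ i)) \<in> cube 1 w" by (simp add: cube_def mem_box_cart)
    ultimately have "(\<chi> i. of_int (w $ i)) \<in> window L" by (auto simp: window_cubes_def)
    then have "- real_of_int \<lfloor>real L / 2\<rfloor> \<le> of_int (w $ i)" "of_int (w $ i) \<le> real_of_int \<lceil>real L / 2\<rceil>"
      by (auto simp: window_def mem_box_cart)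
    then show "- \<lfloor>real L / 2\<rfloor> \<le> w $ i" "w $ i \<le> \<lceil>real L / 2\<rceil>" by linarith+
  qed
  then show ?thesis by (rule finite_subset) (rule finite_int_box)
qed

lemma zero_in_window_cubes:
  assumes "L \<ge> 1"
  shows "0 \<in> (window_cubes L :: (int ^ 'd::finite) set)"
proof -
  have "\<lfloor>real L / 2\<rfloor> \<ge> 0" "\<lceil>real L / 2\<rceil> \<ge> 1" using assms by (auto simp: le_ceiling_iff)
  then have "(0::real) \<le> of_int \<lfloor>real L / 2\<rfloor>" "(1::real) \<le> of_int \<lceil>real L / 2\<rceil>" by linarith+
  then have lo: "- real_of_int \<lfloor>real L / 2\<rfloor> \<le> 0" and hi: "1 \<le> real_of_int \<lceil>real L / 2\<rceil>" by simp_all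
  have "cube 1 0 \<subseteq> (window L :: (real ^ 'd) set)"
  proof
    fix x :: "real ^ 'd" assume "x \<in> cube 1 0"
    then have "0 \<le> x $ i \<and> x $ i \<le> 1" for i by (simp add: cube_def mem_box_cart)
    then show "x \<in> window L"
      using lo hi order_trans unfolding window_def mem_box_cart vec_lambda_beta by blast
  qed
  then show ?thesis by (simp add: window_cubes_def)
qed

section \<open>The percolation measure\<close>

lemma space_site_measure: "space (site_measure p) = UNIV"
  by (simp add: site_measure_def space_PiM)

lemma prob_space_site_measure: "prob_space (site_measure p)"
  unfolding site_measure_def by (intro prob_space_PiM measure_pmf.prob_space_axioms)

lemma pred_black [measurable]:
  "Measurable.pred (site_measure p) (\<lambda>\<omega>. z \<in> black (\<omega> :: int ^ 'd \<Rightarrow> bool))"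
proof -
  have "(\<lambda>\<omega>. \<omega> z) \<in> measurable (site_measure p) (count_space UNIV)"
    using measurable_component_singleton[of z UNIV "\<lambda>_. measure_pmf (bernoulli_pmf p)"]
    by (simp add: site_measure_def measurable_def)
  then show ?thesis by (simp add: black_def)
qed

text \<open>There are only countably many finite lists of sites, so the existence of a path is a
countable union.\<close>

lemma pred_cluster [measurable]:
  "Measurable.pred (site_measure p) (\<lambda>\<omega>. w \<in> cluster adj {z} (black (\<omega> :: int ^ 'd::finite \<Rightarrow> bool)))"
proof -
  have eq: "w \<in> cluster adj {z} A \<longleftrightarrow> (\<exists>xs. (\<forall>x\<in>set xs. x \<in> A) \<and> w \<in> cluster adj {z} (set xs))"
    for A :: "(int ^ 'd) set"
  proof
    assume "w \<in> cluster adj {z} A"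
    from cluster_finite_witness[OF this] obtain F where F: "finite F" "F \<subseteq> A" "w \<in> cluster adj {z} F"
      by blast
    from finite_list[OF F(1)] obtain xs where "set xs = F" ..
    then show "\<exists>xs. (\<forall>x\<in>set xs. x \<in> A) \<and> w \<in> cluster adj {z} (set xs)"
      using F by (intro exI[of _ xs]) auto
  next
    assume "\<exists>xs. (\<forall>x\<in>set xs. x \<in> A) \<and> w \<in> cluster adj {z} (set xs)"
    then obtain xs where xs: "set xs \<subseteq> A" "w \<in> cluster adj {z} (set xs)" by auto
    then show "w \<in> cluster adj {z} A" using cluster_mono[OF order_refl xs(1), of adj "{z}"] by blast
  qed
  have "Measurable.pred (site_measure p)
      (\<lambda>\<omega>. \<exists>xs. (\<forall>x\<in>set xs. x \<in> black (\<omega> :: int ^ 'd \<Rightarrow> bool)) \<and> w \<in> cluster adj {z} (set xs))"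
    by measurable
  then show ?thesis by (subst eq)
qed

lemma measure_cylinder:
  fixes V :: "(int ^ 'd::finite) set"
  assumes "finite V" "A \<subseteq> V" "0 \<le> p" "p \<le> 1"
  shows "measure (site_measure p) {\<omega>. black \<omega> \<inter> V = A} = p ^ card A * (1 - p) ^ card (V - A)"
proof -
  interpret product_prob_space "\<lambda>_::int ^ 'd. measure_pmf (bernoulli_pmf p)" UNIV
    by unfold_locales
  have "{\<omega>. black \<omega> \<inter> V = A}
      = prod_emb UNIV (\<lambda>_. measure_pmf (bernoulli_pmf p)) V (PiE V (\<lambda>z. {z \<in> A}))"
    using assms(2) by (auto simp: prod_emb_def black_def PiE_iff restrict_def)
  then have "measure (site_measure p) {\<omega>. black \<omega> \<inter> V = A}
      = (\<Prod>z\<in>V. measure (measure_pmf (bernoulli_pmf p)) {z \<in> A})"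
    using measure_PiM_emb[OF subset_UNIV assms(1), of "\<lambda>z. {z \<in> A}"] by (simp add: site_measure_def)
  also have "\<dots> = (\<Prod>z\<in>V. if z \<in> A then p else 1 - p)"
    using assms by (intro prod.cong refl) (auto simp: measure_pmf_single)
  also have "\<dots> = (\<Prod>z\<in>V - A. if z \<in> A then p else 1 - p) * (\<Prod>z\<in>A. if z \<in> A then p else 1 - p)"
    using assms by (intro prod.subset_diff) auto
  also have "\<dots> = (\<Prod>z\<in>V - A. 1 - p) * (\<Prod>z\<in>A. p)"
    by (intro arg_cong2[of _ _ _ _ "(*)"] prod.cong) auto
  finally show ?thesis by simp
qed

lemma pred_local [measurable]:
  fixes V :: "(int ^ 'd::finite) set"
  assumes "finite V"
  shows "Measurable.pred (site_measure p) (\<lambda>\<omega>. P (black \<omega> \<inter> V))"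
proof -
  have "P (B \<inter> V) \<longleftrightarrow> (\<exists>A\<in>{A \<in> Pow V. P A}. \<forall>z\<in>V. z \<in> B \<longleftrightarrow> z \<in> A)" for B
  proof
    assume "P (B \<inter> V)"
    then show "\<exists>A\<in>{A \<in> Pow V. P A}. \<forall>z\<in>V. z \<in> B \<longleftrightarrow> z \<in> A" by (intro bexI[of _ "B \<inter> V"]) auto
  next
    assume "\<exists>A\<in>{A \<in> Pow V. P A}. \<forall>z\<in>V. z \<in> B \<longleftrightarrow> z \<in> A"
    then obtain A where "A \<subseteq> V" "P A" "\<forall>z\<in>V. z \<in> B \<longleftrightarrow> z \<in> A" by blast
    moreover from this have "B \<inter> V = A" by blast
    ultimately show "P (B \<inter> V)" by simp
  qed
  moreover have "Measurable.pred (site_measure p) (\<lambda>\<omega>. \<exists>A\<in>{A \<in> Pow V. P A}. \<forall>z\<in>V. z \<in> black \<omega> \<longleftrightarrow> z \<in> A)"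
  proof (rule pred_intros_finite)
    fix A
    show "Measurable.pred (site_measure p) (\<lambda>\<omega>. \<forall>z\<in>V. z \<in> black \<omega> \<longleftrightarrow> z \<in> A)"
      by (rule pred_intros_finite[OF assms]) measurable
  qed (use assms in simp)
  ultimately show ?thesis by simp
qed

text \<open>The probability of an event that depends on finitely many sites is a finite sum, which transfers the
finite percolation estimates to the infinite lattice.\<close>

lemma measure_local_event:
  fixes V :: "(int ^ 'd::finite) set"
  assumes V: "finite V" and p: "0 \<le> p" "p \<le> 1"
  shows "measure (site_measure p) {\<omega>. P (black \<omega> \<inter> V)} = site_expectation p V (\<lambda>A. of_bool (P A))"
proof -
  interpret prob_space "site_measure p" by (rule prob_space_site_measure)
  have "{\<omega>. P (black \<omega> \<inter> V)} = (\<Union>A\<in>{A \<in> Pow V. P A}. {\<omega>. black \<omega> \<inter> V = A})"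
    by auto
  also have "measure (site_measure p) \<dots> = (\<Sum>A\<in>{A \<in> Pow V. P A}. measure (site_measure p) {\<omega>. black \<omega> \<inter> V = A})"
  proof (rule finite_measure_finite_Union)
    show "(\<lambda>A. {\<omega>. black \<omega> \<inter> V = A}) ` {A \<in> Pow V. P A} \<subseteq> sets (site_measure p)"
      using pred_local[OF V, where p = p] by (auto simp: pred_def space_site_measure)
    show "disjoint_family_on (\<lambda>A. {\<omega>. black \<omega> \<inter> V = A}) {A \<in> Pow V. P A}"
      by (auto simp: disjoint_family_on_def)
  qed (use V in simp)
  also have "\<dots> = (\<Sum>A\<in>{A \<in> Pow V. P A}. p ^ card A * (1 - p) ^ card (V - A))"
    using V p by (intro sum.cong refl measure_cylinder) auto
  also have "\<dots> = site_expectation p V (\<lambda>A. of_bool (P A))"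
    unfolding site_expectation_def using V by (intro sum.mono_neutral_cong_left) auto
  finally show ?thesis .
qed

lemma theta_eq:
  "theta TYPE('d::finite) p = measure (site_measure p)
     {\<omega>. 0 \<in> black \<omega> \<and> infinite (cluster adj {0 :: int ^ 'd} (black \<omega>))}"
  unfolding theta_def by (rule arg_cong[of _ _ "measure _"]) (auto simp: origin_cubes space_site_measure)

text \<open>These events decrease, as \<open>M\<close> grows, to the event that the cluster is infinite.
The size is expressed by lists, which keeps the events manifestly measurable and makes sense for
infinite clusters.\<close>

lemma cluster_tail_vanishes:
  assumes "theta TYPE('d::finite) p = 0" and "0 < \<eta>"
  shows "\<exists>M. measure (site_measure p)
    {\<omega>. 0 \<in> black \<omega> \<and> (\<exists>xs. distinct xs \<and> M < length xs \<and> set xs \<subseteq> cluster adj {0 :: int ^ 'd} (black \<omega>))} < \<eta>"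
proof -
  interpret prob_space "site_measure p" by (rule prob_space_site_measure)
  let ?C = "\<lambda>\<omega>. cluster adj {0 :: int ^ 'd} (black \<omega>)"
  define B where "B = (\<lambda>M. {\<omega>. 0 \<in> black \<omega> \<and> (\<exists>xs. distinct xs \<and> M < length xs \<and> (\<forall>x\<in>set xs. x \<in> ?C \<omega>))})"
  have "Measurable.pred (site_measure p) (\<lambda>\<omega>. 0 \<in> black \<omega> \<and> (\<exists>xs. distinct xs \<and> M < length xs \<and> (\<forall>x\<in>set xs. x \<in> ?C \<omega>)))" for M
    by measurable
  then have sets: "range B \<subseteq> sets (site_measure p)"
    by (auto simp: B_def pred_def space_site_measure)
  have dec: "decseq B" unfolding B_def decseq_def by (auto intro: le_less_trans)
  have sub: "\<omega> \<in> (\<Inter>M. B M) \<longleftrightarrow> 0 \<in> black \<omega> \<and> infinite (?C \<omega>)" for \<omega>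
  proof
    assume \<omega>: "\<omega> \<in> (\<Inter>M. B M)"
    have "infinite (?C \<omega>)"
    proof
      assume fin: "finite (?C \<omega>)"
      obtain xs where xs: "distinct xs" "card (?C \<omega>) < length xs" "set xs \<subseteq> ?C \<omega>"
        using \<omega> unfolding B_def by blast
      have "card (set xs) \<le> card (?C \<omega>)" using fin xs(3) by (rule card_mono)
      then show False using xs distinct_card by fastforce
    qed
    then show "0 \<in> black \<omega> \<and> infinite (?C \<omega>)" using \<omega> by (auto simp: B_def)
  next
    assume \<omega>: "0 \<in> black \<omega> \<and> infinite (?C \<omega>)"
    show "\<omega> \<in> (\<Inter>M. B M)"
    proof
      fix M
      obtain F where F: "finite F" "card F = Suc M" "F \<subseteq> ?C \<omega>"
        using \<omega> infinite_arbitrarily_large by blast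
      obtain xs where xs: "set xs = F" "distinct xs" using finite_distinct_list[OF F(1)] by blast
      then have "M < length xs" using F distinct_card[of xs] by simp
      then show "\<omega> \<in> B M" unfolding B_def using xs F \<omega> by blast
    qed
  qed
  then have "(\<Inter>M. B M) = {\<omega>. 0 \<in> black \<omega> \<and> infinite (?C \<omega>)}" by blast
  then have "measure (site_measure p) (\<Inter>M. B M) = 0"
    using assms(1) by (simp add: theta_eq)
  then have "(\<lambda>M. measure (site_measure p) (B M)) \<longlonglongrightarrow> 0"
    using finite_Lim_measure_decseq[OF sets dec] by simp
  then have "eventually (\<lambda>M. measure (site_measure p) (B M) < \<eta>) sequentially"
    using assms(2) by (rule order_tendstoD)
  then obtain M where "measure (site_measure p) (B M) < \<eta>"
    by (auto simp: eventually_sequentially)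
  then show ?thesis unfolding B_def subset_eq by (rule exI)
qed

section \<open>The subcritical phase\<close>

text \<open>At density one all sites are black almost surely. This places the critical
probability at or below one.\<close>

lemma theta_one: "theta TYPE('d::finite) 1 > 0"
proof -
  interpret prob_space "site_measure 1 :: (int ^ 'd \<Rightarrow> bool) measure" by (rule prob_space_site_measure)
  let ?M = "site_measure 1 :: (int ^ 'd \<Rightarrow> bool) measure"
  have "AE \<omega> in ?M. \<forall>z. z \<in> black \<omega>"
  proof (subst AE_all_countable, intro allI)
    fix z :: "int ^ 'd"
    have "measure ?M {\<omega>. z \<in> black \<omega> \<inter> {z}} = site_expectation 1 {z} (\<lambda>A. of_bool (z \<in> A))"
      by (rule measure_local_event) auto
    also have "\<dots> = 1" by (simp add: site_expectation_insert)
    finally have "prob {\<omega> \<in> space ?M. z \<in> black \<omega>} = 1" by (simp add: space_site_measure)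
    moreover have "{\<omega> \<in> space ?M. z \<in> black \<omega>} \<in> events" by measurable
    ultimately show "AE \<omega> in ?M. z \<in> black \<omega>"
      using prob_Collect_eq_1[of "\<lambda>\<omega>. z \<in> black \<omega>"] by simp
  qed
  then have AE: "AE \<omega> in ?M. \<omega> \<in> {\<omega>. 0 \<in> black \<omega> \<and> infinite (cluster adj {0 :: int ^ 'd} (black \<omega>))}"
  proof eventually_elim
    case (elim \<omega>)
    then have black: "black \<omega> = UNIV" by auto
    fix i :: 'd
    have step: "axis i (int n) \<in> cluster adj {0} UNIV" for n
    proof (induction n)
      case 0
      then show ?case using cluster_self[of 0 adj UNIV] by (simp add: axis_def zero_vec_def)
    next
      case (Suc n)
      have "axis i (int (Suc n)) = axis i (int n) + axis i 1" by (auto simp: axis_def vec_eq_iff)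
      then have "adj (axis i (int n)) (axis i (int (Suc n)))" by (auto simp: adj_def)
      then show ?case by (rule cluster_step[OF Suc.IH _ UNIV_I])
    qed
    have "inj (\<lambda>n. axis i (int n) :: int ^ 'd)" by (auto simp: inj_def axis_eq_axis)
    then have "infinite (range (\<lambda>n. axis i (int n) :: int ^ 'd))" by (rule range_inj_infinite)
    moreover have "range (\<lambda>n. axis i (int n)) \<subseteq> cluster adj {0 :: int ^ 'd} UNIV" using step by blast
    ultimately have "infinite (cluster adj {0 :: int ^ 'd} UNIV)" using finite_subset by blast
    then show ?case using black by simp
  qed
  have "{\<omega> \<in> space ?M. 0 \<in> black \<omega> \<and> infinite (cluster adj {0 :: int ^ 'd} (black \<omega>))} \<in> events"
  proof -
    have inf: "infinite S \<longleftrightarrow> (\<forall>xs. \<exists>w. w \<notin> set xs \<and> w \<in> S)" for S :: "(int ^ 'd) set"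
      by (metis List.finite_set finite_list finite_subset subsetI)
    show ?thesis unfolding inf by measurable
  qed
  then have "{\<omega>. 0 \<in> black \<omega> \<and> infinite (cluster adj {0 :: int ^ 'd} (black \<omega>))} \<in> events"
    by (simp add: space_site_measure)
  then have "prob {\<omega>. 0 \<in> black \<omega> \<and> infinite (cluster adj {0 :: int ^ 'd} (black \<omega>))} = 1"
    using AE prob_eq_1 by blast
  then show ?thesis by (simp add: theta_eq)
qed

lemma theta_nonneg: "theta t p \<ge> 0"
  by (simp add: theta_def)

lemma theta_below_critical:
  assumes "0 < p" "p < critical_probability TYPE('d::finite)"
  obtains q where "p < q" "q \<le> 1" "theta TYPE('d) q = 0"
proof -
  let ?S = "{p \<in> {0..1}. theta TYPE('d) p > 0}"
  have bdd: "bdd_below ?S" by (rule bdd_belowI[of _ 0]) auto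
  have "1 \<in> ?S" using theta_one by simp
  then have le1: "critical_probability TYPE('d) \<le> 1"
    unfolding critical_probability_def using bdd by (rule cInf_lower)
  define q where "q = (p + critical_probability TYPE('d)) / 2"
  have q: "p < q" "q < critical_probability TYPE('d)" using assms by (auto simp: q_def)
  have "q \<notin> ?S"
  proof
    assume "q \<in> ?S"
    then have "critical_probability TYPE('d) \<le> q"
      unfolding critical_probability_def using bdd by (rule cInf_lower)
    then show False using q by simp
  qed
  then have "theta TYPE('d) q = 0" using q assms le1 theta_nonneg[of "TYPE('d)" q] by force
  then show ?thesis using that q le1 by force
qed

text \<open>Translation moves \<open>v\<close> to the origin. The extra factor \<open>p\<close> is the probability that the origin, whose
occupation is taken for granted on the left, is black.\<close>

lemma finite_volume_tail_le:
  fixes R :: "(int ^ 'd::finite) set"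
  assumes p: "0 < p" "p \<le> 1" and R: "finite R" "v \<notin> R"
  shows "site_expectation p R (\<lambda>A. of_bool (M < card (cluster adj {v} A))) * p \<le> measure (site_measure p)
    {\<omega>. 0 \<in> black \<omega> \<and> (\<exists>xs. distinct xs \<and> M < length xs \<and> set xs \<subseteq> cluster adj {0 :: int ^ 'd} (black \<omega>))}"
    (is "_ \<le> measure _ ?B")
proof -
  interpret prob_space "site_measure p :: (int ^ 'd \<Rightarrow> bool) measure" by (rule prob_space_site_measure)
  define R0 where "R0 = (\<lambda>w. w - v) ` R"
  have R0: "finite R0" "0 \<notin> R0" using R by (auto simp: R0_def)
  have R_eq: "R = (+) v ` R0" by (auto simp: R0_def image_image)
  have card_eq: "card (cluster adj {v} ((+) v ` A)) = card (cluster adj {0} A)" for A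
  proof -
    have "cluster adj {v} ((+) v ` A) = (+) v ` cluster adj {0} A"
      using cluster_image[of adj "(+) v" "{0}" A, OF adj_translate] by simp
    then show ?thesis by (simp add: card_image)
  qed
  have "site_expectation p R (\<lambda>A. of_bool (M < card (cluster adj {v} A)))
      = site_expectation p R0 (\<lambda>A. of_bool (M < card (cluster adj {0} A)))"
    unfolding R_eq by (subst site_expectation_image) (simp_all add: card_eq)
  also have "\<dots> = site_expectation p R0 (\<lambda>A. of_bool (0 \<in> insert 0 A \<and> M < card (cluster adj {0} (insert 0 A))))"
  proof (rule site_expectation_cong)
    fix A assume "A \<subseteq> R0"
    have "cluster adj {0} (insert 0 A) = cluster adj {0} A"
      using cluster_remove[of 0 "{0}" adj "insert 0 A"] cluster_remove[of 0 "{0}" adj A] by simp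
    then show "(of_bool (M < card (cluster adj {0} A)) :: real) =
        of_bool (0 \<in> insert 0 A \<and> M < card (cluster adj {0} (insert 0 A)))" by simp
  qed
  also have "\<dots> * p = site_expectation p (insert 0 R0) (\<lambda>A. of_bool (0 \<in> A \<and> M < card (cluster adj {0} A)))"
  proof -
    have "site_expectation p R0 (\<lambda>A. of_bool (0 \<in> A \<and> M < card (cluster adj {0} A))) = site_expectation p R0 (\<lambda>_. 0)"
      using R0 by (intro site_expectation_cong) auto
    then show ?thesis using R0 by (simp add: site_expectation_insert site_expectation_const)
  qed
  also have "\<dots> = measure (site_measure p) {\<omega>. 0 \<in> black \<omega> \<inter> insert 0 R0 \<and> M < card (cluster adj {0} (black \<omega> \<inter> insert 0 R0))}"
    using R0 p by (intro measure_local_event[symmetric, where P = "\<lambda>A. 0 \<in> A \<and> M < card (cluster adj {0} A)"]) auto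
  also have "\<dots> \<le> measure (site_measure p) ?B"
  proof (rule finite_measure_mono)
    show "{\<omega>. 0 \<in> black \<omega> \<inter> insert 0 R0 \<and> M < card (cluster adj {0} (black \<omega> \<inter> insert 0 R0))} \<subseteq> ?B"
    proof
      fix \<omega> assume \<omega>: "\<omega> \<in> {\<omega>. 0 \<in> black \<omega> \<inter> insert 0 R0 \<and> M < card (cluster adj {0} (black \<omega> \<inter> insert 0 R0))}"
      have fin: "finite (cluster adj {0} (black \<omega> \<inter> insert 0 R0))" using R0 by (intro finite_cluster) auto
      obtain xs where xs: "set xs = cluster adj {0} (black \<omega> \<inter> insert 0 R0)" "distinct xs"
        using finite_distinct_list[OF fin] by auto
      have "set xs \<subseteq> cluster adj {0} (black \<omega>)"
        unfolding xs(1) by (intro cluster_mono) auto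
      moreover have "M < length xs" using \<omega> distinct_card[OF xs(2)] unfolding xs(1) by simp
      ultimately show "\<omega> \<in> ?B" using xs \<omega> by blast
    qed
    have "Measurable.pred (site_measure p) (\<lambda>\<omega>. 0 \<in> black \<omega> \<and>
        (\<exists>xs. distinct xs \<and> M < length xs \<and> (\<forall>x\<in>set xs. x \<in> cluster adj {0 :: int ^ 'd} (black \<omega>))))"
      by measurable
    then show "?B \<in> events" by (simp add: pred_def space_site_measure subset_eq)
  qed
  finally show ?thesis .
qed

text \<open>Choose \<open>q\<close> above \<open>p\<close> with no infinite cluster, and write \<open>\<delta> = p / q\<close>. For a suitable
size \<open>M\<close>, the cluster at \<open>q\<close> of a black site has at most \<open>M\<close> sites with probability at least
\<open>sqrt \<delta>\<close>; and marks can be chosen so rare that \<open>M\<close> sites remain unmarked with probability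
at least \<open>sqrt \<delta>\<close>. Then clusters at \<open>q\<close> are unmarked with probability at least \<open>\<delta>\<close>, uniformly in the
region, as the comparison of densities requires.\<close>

lemma subcritical_volume_decay:
  assumes "0 < p" "p < critical_probability TYPE('d::finite)"
  obtains s K :: real where "0 < s" "s < 1" "0 < K"
    "\<And>(R :: (int ^ 'd) set) v m. finite R \<Longrightarrow> v \<notin> R \<Longrightarrow>
       site_expectation p R (\<lambda>A. of_bool (m \<le> card (cluster adj {v} A))) \<le> K * s ^ m"
proof -
  obtain q where q: "p < q" "q \<le> 1" "theta TYPE('d) q = 0" using theta_below_critical[OF assms] .
  define \<delta> where "\<delta> = p / q"
  have \<delta>: "0 < \<delta>" "\<delta> < 1" using assms q by (auto simp: \<delta>_def)
  then have sq: "0 < sqrt \<delta>" "sqrt \<delta> < 1" by auto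
  obtain M where M: "measure (site_measure q)
    {\<omega>. 0 \<in> black \<omega> \<and> (\<exists>xs. distinct xs \<and> M < length xs \<and> set xs \<subseteq> cluster adj {0 :: int ^ 'd} (black \<omega>))}
      < q * (1 - sqrt \<delta>)"
    using cluster_tail_vanishes[OF q(3), of "q * (1 - sqrt \<delta>)"] assms q sq by auto
  define s where "s = root (Suc M) (sqrt \<delta>)"
  have s: "0 < s" "s < 1" using sq by (auto simp: s_def)
  have "sqrt \<delta> = s ^ Suc M" unfolding s_def using sq by (intro real_root_pow_pos2[symmetric]) auto
  also have "\<dots> \<le> s ^ M" using s by (intro power_decreasing) auto
  finally have sM: "sqrt \<delta> \<le> s ^ M" .
  have low: "\<delta> \<le> site_expectation q R (\<lambda>A. s ^ card (cluster adj {v} A))" if R: "finite R" "v \<notin> R" for R and v :: "int ^ 'd"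
  proof -
    let ?T = "site_expectation q R (\<lambda>A. of_bool (M < card (cluster adj {v} A)))"
    have "?T * q \<le> q * (1 - sqrt \<delta>)"
      using finite_volume_tail_le[of q R v M] M R assms q by linarith
    then have T: "?T \<le> 1 - sqrt \<delta>" using assms q by (simp add: mult.commute)
    have "\<delta> = sqrt \<delta> * sqrt \<delta>" using \<delta> by simp
    also have "\<dots> \<le> s ^ M * (1 - ?T)" using sM T sq s by (intro mult_mono) auto
    also have "1 - ?T = site_expectation q R (\<lambda>A. 1 + (- 1) * of_bool (M < card (cluster adj {v} A)))"
      unfolding site_expectation_add site_expectation_cmult using R by (simp add: site_expectation_const)
    also have "s ^ M * \<dots> = site_expectation q R (\<lambda>A. s ^ M * (1 + (- 1) * of_bool (M < card (cluster adj {v} A))))"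
      by (rule site_expectation_cmult[symmetric])
    also have "\<dots> \<le> site_expectation q R (\<lambda>A. s ^ card (cluster adj {v} A))"
      using assms q s by (intro site_expectation_mono) (auto simp: not_less intro: power_decreasing)
    finally show ?thesis .
  qed
  have "site_expectation p R (\<lambda>A. of_bool (m \<le> card (cluster adj {v} A))) \<le> (1 / \<delta>) * s ^ m"
    if "finite R" "v \<notin> R" for R and v :: "int ^ 'd" and m
  proof -
    have "site_expectation p R (\<lambda>A. of_bool (m \<le> card (cluster adj {v} A))) \<le> s ^ m / \<delta>"
      by (rule cluster_volume_decay[of q s p \<delta>])
        (use low that assms q s \<delta> in \<open>simp_all add: \<delta>_def\<close>)
    then show ?thesis by simp
  qed
  then show ?thesis using that[of s "1 / \<delta>"] s \<delta> by simp
qed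

section \<open>Clusters counted by the empirical measure\<close>

text \<open>Stronger than having no black neighbour: the whole block around \<open>z\<close> is white except for
\<open>z\<close>. It then suffices to know the size of the block.\<close>

definition isolated :: "int ^ 'd \<Rightarrow> (int ^ 'd) set \<Rightarrow> bool" where
  "isolated z Z \<longleftrightarrow> Z \<inter> around z = {z}"

text \<open>Truncating the colouring to \<open>W\<close> makes the event depend on finitely many sites. It keeps every cluster
that is contained in \<open>W\<close>.\<close>

definition large_cluster_within :: "(int ^ 'd) set \<Rightarrow> nat \<Rightarrow> int ^ 'd \<Rightarrow> (int ^ 'd) set \<Rightarrow> bool" where
  "large_cluster_within W m z Z \<longleftrightarrow> m \<le> card (cluster adj {z} (Z \<inter> W))"

lemma self_in_around: "z \<in> around z"
  by (simp add: around_def)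

lemma adj_around: "adj z w \<Longrightarrow> w \<in> around z"
  by (auto simp: adj_def around_def axis_def)

lemma cluster_isolated:
  assumes "isolated z Z"
  shows "z \<in> Z" "cluster adj {z} Z = {z}"
proof -
  show "z \<in> Z" using assms by (auto simp: isolated_def)
  have "cluster adj {z} Z \<subseteq> {z}"
    by (rule cluster_least) (use assms adj_around in \<open>auto simp: isolated_def\<close>)
  then show "cluster adj {z} Z = {z}" using cluster_self[of z adj Z] by blast
qed

lemma measure_isolated:
  fixes z :: "int ^ 'd::finite"
  assumes "0 \<le> p" "p \<le> 1"
  shows "measure (site_measure p) {\<omega>. isolated z (black \<omega>)} = p * (1 - p) ^ (card (around (0 :: int ^ 'd)) - 1)"
proof -
  have "measure (site_measure p) {\<omega>. black \<omega> \<inter> around z = {z}}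
      = p ^ card {z} * (1 - p) ^ card (around z - {z})"
    using assms finite_around self_in_around by (intro measure_cylinder) auto
  moreover have "card (around z - {z}) = card (around (0 :: int ^ 'd)) - 1"
    using finite_around[of z] self_in_around[of z] card_around[of z] by simp
  ultimately show ?thesis by (simp add: isolated_def)
qed

lemma measure_large_cluster_within:
  fixes W :: "(int ^ 'd::finite) set"
  assumes "0 \<le> p" "p \<le> 1" "finite W"
  shows "measure (site_measure p) {\<omega>. large_cluster_within W m z (black \<omega>)}
    = site_expectation p (W - {z}) (\<lambda>A. of_bool (m \<le> card (cluster adj {z} A)))"
proof -
  have eq: "cluster adj {z} (Z \<inter> W) = cluster adj {z} (Z \<inter> (W - {z}))" for Z
    using cluster_remove[of z "{z}" adj "Z \<inter> W"] by (simp add: Int_Diff)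
  have "measure (site_measure p) {\<omega>. m \<le> card (cluster adj {z} (black \<omega> \<inter> (W - {z})))}
    = site_expectation p (W - {z}) (\<lambda>A. of_bool (m \<le> card (cluster adj {z} A)))"
    using assms by (intro measure_local_event[where P = "\<lambda>A. m \<le> card (cluster adj {z} A)"]) auto
  then show ?thesis unfolding large_cluster_within_def by (subst eq)
qed

lemma complexes_cluster:
  fixes Z :: "(int ^ 'd::finite) set"
  assumes "K \<in> clusters Z" "finite K"
  shows "cubical_set K \<in> complexes"
proof -
  obtain z where z: "z \<in> Z" "K = cluster adj {z} Z" using assms(1) by (auto simp: clusters_def)
  have "z \<in> K" using z cluster_self by metis
  then have "cubical_set K \<noteq> {}" using center_in_cubical_set by blast
  then show ?thesis using connected_cubical_cluster[OF z(1)] assms(2) unfolding complexes_def z(2) by blast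
qed

context
  fixes W Z :: "(int ^ 'd::finite) set"
  assumes finite_W: "finite W"
begin

lemma finite_clusters_confined: "finite (clusters (confined W Z))"
proof -
  have "clusters (confined W Z) \<subseteq> Pow W" by (auto simp: clusters_confined)
  then show ?thesis using finite_W finite_subset by blast
qed

lemma card_clusters_confined_le: "card (clusters (confined W Z)) \<le> card W"
proof -
  have "confined W Z \<subseteq> W" using cluster_self[of _ adj Z] by (auto simp: confined_def)
  then have "card (confined W Z) \<le> card W" "finite (confined W Z)"
    using finite_W by (auto intro: card_mono finite_subset)
  then show ?thesis unfolding clusters_def using card_image_le order_trans by blast
qed

lemma isolated_singleton_cluster:
  assumes "z \<in> W" "isolated z Z"
  shows "{z} \<in> clusters (confined W Z)"
proof -
  have "{z} \<in> clusters Z"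
    using cluster_isolated[OF assms(2)] unfolding clusters_def by (intro image_eqI[of _ _ z]) auto
  then show ?thesis using assms(1) by (simp add: clusters_confined)
qed

lemma card_isolated_le: "card {z \<in> W. isolated z Z} \<le> card {K \<in> clusters (confined W Z). \<exists>z. K = {z}}"
proof -
  have "(\<lambda>z. {z}) ` {z \<in> W. isolated z Z} \<subseteq> {K \<in> clusters (confined W Z). \<exists>z. K = {z}}"
    using isolated_singleton_cluster by blast
  then have "card ((\<lambda>z. {z}) ` {z \<in> W. isolated z Z}) \<le> card {K \<in> clusters (confined W Z). \<exists>z. K = {z}}"
    using finite_clusters_confined by (intro card_mono) auto
  then show ?thesis by (simp add: card_image)
qed

lemma card_large_clusters_le:
  "card {K \<in> clusters (confined W Z). m \<le> card K} \<le> card {z \<in> W. large_cluster_within W m z Z}"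
proof -
  have "{K \<in> clusters (confined W Z). m \<le> card K}
      \<subseteq> (\<lambda>z. cluster adj {z} (Z \<inter> W)) ` {z \<in> W. large_cluster_within W m z Z}"
  proof
    fix K assume "K \<in> {K \<in> clusters (confined W Z). m \<le> card K}"
    then have "K \<in> clusters Z" and KW: "K \<subseteq> W" "m \<le> card K" by (simp_all add: clusters_confined)
    then obtain z where "z \<in> Z" "K = cluster adj {z} Z" unfolding clusters_def by blast
    note z = this KW
    have K: "K = cluster adj {z} (Z \<inter> W)"
      using cluster_restrict[of adj "{z}" Z W] z by simp
    have "z \<in> W" using z cluster_self[of z adj Z] by blast
    then show "K \<in> (\<lambda>z. cluster adj {z} (Z \<inter> W)) ` {z \<in> W. large_cluster_within W m z Z}"
      using K z(4) unfolding large_cluster_within_def by blast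
  qed
  then have "card {K \<in> clusters (confined W Z). m \<le> card K}
      \<le> card ((\<lambda>z. cluster adj {z} (Z \<inter> W)) ` {z \<in> W. large_cluster_within W m z Z})"
    using finite_W by (intro card_mono) auto
  also have "\<dots> \<le> card {z \<in> W. large_cluster_within W m z Z}"
    using finite_W by (intro card_image_le) auto
  finally show ?thesis .
qed

end

lemma prob_empirical_measure:
  fixes Z :: "(int ^ 'd::finite) set" and L :: nat
  defines "\<K> \<equiv> clusters (confined (window_cubes L) Z)"
  assumes "\<K> \<noteq> {}"
  shows "measure_pmf.prob (empirical_measure \<nu> L Z) T
    = card {K \<in> \<K>. homotopy_type (cubical_set K) \<in> T} / card \<K>"
proof -
  have fin: "finite \<K>" unfolding \<K>_def by (rule finite_clusters_confined[OF finite_window_cubes])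
  have comps: "components (windowed_set L Z) = cubical_set ` \<K>"
    unfolding \<K>_def by (rule components_windowed_set)
  have inj: "inj_on cubical_set X" for X :: "(int ^ 'd) set set"
    by (simp add: inj_on_def cubical_set_eq_iff)
  have "measure_pmf.prob (empirical_measure \<nu> L Z) T
      = measure_pmf.prob (pmf_of_set (cubical_set ` \<K>)) (homotopy_type -` T)"
    unfolding empirical_measure_def comps using assms(2) by (simp add: measure_map_pmf)
  also have "\<dots> = card (cubical_set ` \<K> \<inter> homotopy_type -` T) / card (cubical_set ` \<K>)"
    using fin assms(2) by (subst measure_pmf_of_set) auto
  also have "cubical_set ` \<K> \<inter> homotopy_type -` T = cubical_set ` {K \<in> \<K>. homotopy_type (cubical_set K) \<in> T}"
    by auto
  finally show ?thesis by (simp add: card_image[OF inj])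
qed

lemma betti_tail_cluster:
  fixes Z :: "(int ^ 'd::finite) set"
  assumes "K \<in> clusters (confined W Z)" "finite W" "homotopy_type (cubical_set K) \<in> betti_tail k n"
  shows "enat n \<le> betti k (cubical_set K)" "finite K"
proof -
  show fin: "finite K" using assms(1,2) finite_subset by (auto simp: clusters_confined)
  have "cubical_set K \<in> complexes" using assms(1) fin by (rule complexes_cluster)
  then show "enat n \<le> betti k (cubical_set K)"
    using assms(3) betti_type_homotopy_type[of "cubical_set K" k] by (simp add: betti_tail_def)
qed

text \<open>A component with at least \<open>n\<close> holes has at least \<open>n div D\<close> cubes, and each isolated cube of the
window is a component of its own, so the denominator is at least their number.\<close>

lemma prob_empirical_betti_tail_le:
  fixes Z :: "(int ^ 'd::finite) set" and L :: nat
  defines "W \<equiv> window_cubes L :: (int ^ 'd) set"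
  assumes D: "\<And>F :: (int ^ 'd) set. finite F \<Longrightarrow> betti k (cubical_set F) \<le> enat (D * card F)" "D > 0"
    and X: "card {z \<in> W. isolated z Z} > 0"
  shows "measure_pmf.prob (empirical_measure \<nu> L Z) (betti_tail k n)
    \<le> card {z \<in> W. large_cluster_within W (n div D) z Z} / card {z \<in> W. isolated z Z}"
proof -
  let ?\<K> = "clusters (confined W Z)"
  have W: "finite W" unfolding W_def by (rule finite_window_cubes)
  note fin = finite_clusters_confined[OF W, of Z]
  have le: "card {z \<in> W. isolated z Z} \<le> card ?\<K>"
    using card_isolated_le[OF W, of Z] card_mono[OF fin, of "{K \<in> ?\<K>. \<exists>z. K = {z}}"] by auto
  then have "?\<K> \<noteq> {}" using X by auto
  then have "measure_pmf.prob (empirical_measure \<nu> L Z) (betti_tail k n)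
      = card {K \<in> ?\<K>. homotopy_type (cubical_set K) \<in> betti_tail k n} / card ?\<K>"
    unfolding W_def by (rule prob_empirical_measure)
  also have "\<dots> \<le> card {z \<in> W. large_cluster_within W (n div D) z Z} / card {z \<in> W. isolated z Z}"
  proof (intro frac_le)
    have "{K \<in> ?\<K>. homotopy_type (cubical_set K) \<in> betti_tail k n} \<subseteq> {K \<in> ?\<K>. n div D \<le> card K}"
    proof
      fix K assume K: "K \<in> {K \<in> ?\<K>. homotopy_type (cubical_set K) \<in> betti_tail k n}"
      then have "enat n \<le> betti k (cubical_set K)" "finite K" using betti_tail_cluster W by blast+
      then have "n \<le> D * card K" using D(1) order_trans by fastforce
      then have "n div D \<le> D * card K div D" by (rule div_le_mono)
      then show "K \<in> {K \<in> ?\<K>. n div D \<le> card K}" using K D(2) by simp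
    qed
    then have "card {K \<in> ?\<K>. homotopy_type (cubical_set K) \<in> betti_tail k n} \<le> card {K \<in> ?\<K>. n div D \<le> card K}"
      using fin by (intro card_mono) auto
    then show "real (card {K \<in> ?\<K>. homotopy_type (cubical_set K) \<in> betti_tail k n})
        \<le> real (card {z \<in> W. large_cluster_within W (n div D) z Z})"
      using card_large_clusters_le[OF W, of Z "n div D"] by simp
  qed (use X le in auto)
  finally show ?thesis .
qed

text \<open>Isolated cubes are convex components without holes, and there are at most \<open>card W\<close>
components in all.\<close>

lemma prob_empirical_betti_tail_le_isolated:
  fixes Z :: "(int ^ 'd::finite) set" and L :: nat
  defines "W \<equiv> window_cubes L :: (int ^ 'd) set"
  assumes "0 < k" "1 \<le> n" and X: "card {z \<in> W. isolated z Z} > 0"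
  shows "measure_pmf.prob (empirical_measure \<nu> L Z) (betti_tail k n)
    \<le> 1 - card {z \<in> W. isolated z Z} / card W"
proof -
  let ?\<K> = "clusters (confined W Z)" and ?S = "{K \<in> clusters (confined W Z). \<exists>z. K = {z}}"
  let ?B = "{K \<in> ?\<K>. homotopy_type (cubical_set K) \<in> betti_tail k n}"
  have W: "finite W" unfolding W_def by (rule finite_window_cubes)
  note fin = finite_clusters_confined[OF W, of Z]
  have XS: "card {z \<in> W. isolated z Z} \<le> card ?S" using W by (rule card_isolated_le)
  have SK: "card ?S \<le> card ?\<K>" using fin by (intro card_mono) auto
  have pos: "0 < card ?\<K>" using XS SK X by linarith
  then have "?\<K> \<noteq> {}" by auto
  then have "measure_pmf.prob (empirical_measure \<nu> L Z) (betti_tail k n) = card ?B / card ?\<K>"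
    unfolding W_def by (rule prob_empirical_measure)
  also have "\<dots> \<le> (real (card ?\<K>) - card ?S) / card ?\<K>"
  proof (rule divide_right_mono)
    have "?B \<inter> ?S = {}"
    proof -
      have False if "K \<in> ?B" "K \<in> ?S" for K
      proof -
        obtain z where "K = {z}" using \<open>K \<in> ?S\<close> by blast
        then have "betti k (cubical_set K) = 0" using betti_cube[OF assms(2)] by simp
        moreover have "enat n \<le> betti k (cubical_set K)" using betti_tail_cluster(1) W \<open>K \<in> ?B\<close> by blast
        ultimately show False using assms(3) by (simp add: zero_enat_def)
      qed
      then show ?thesis by blast
    qed
    then have "card ?B + card ?S = card (?B \<union> ?S)" using fin by (intro card_Un_disjoint[symmetric]) auto
    also have "\<dots> \<le> card ?\<K>" using fin by (intro card_mono) auto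
    finally show "real (card ?B) \<le> real (card ?\<K>) - card ?S" by simp
  qed simp
  also have "\<dots> = 1 - card ?S / card ?\<K>" using pos by (simp add: diff_divide_distrib)
  also have "\<dots> \<le> 1 - card {z \<in> W. isolated z Z} / card W"
    using XS pos card_clusters_confined_le[OF W, of Z] by (intro diff_left_mono frac_le) auto
  finally show ?thesis .
qed

section \<open>Passage to the limit measure\<close>

lemma tv_dist_ge:
  "\<bar>measure_pmf.prob P A - measure_pmf.prob Q A\<bar> \<le> tv_dist P Q"
  unfolding tv_dist_def
proof (rule cSUP_upper)
  have "\<bar>measure_pmf.prob P A - measure_pmf.prob Q A\<bar> \<le> 1" for A
    using measure_pmf.prob_le_1[of P A] measure_pmf.prob_le_1[of Q A]
      measure_nonneg[of "measure_pmf P" A] measure_nonneg[of "measure_pmf Q" A] by linarith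
  then show "bdd_above (range (\<lambda>A. \<bar>measure_pmf.prob P A - measure_pmf.prob Q A\<bar>))"
    by (intro bdd_aboveI) auto
qed simp

text \<open>The window contains finitely many sites, so there are finitely many possible values of the
confined set.\<close>

lemma pred_confined:
  fixes W :: "(int ^ 'd::finite) set"
  assumes "finite W"
  shows "Measurable.pred (site_measure p) (\<lambda>\<omega>. \<Phi> (confined W (black \<omega>)))"
proof -
  have sub: "confined W Z \<subseteq> W" for Z :: "(int ^ 'd) set"
    using cluster_self[of _ adj Z] by (auto simp: confined_def)
  have "\<Phi> (confined W Z) \<longleftrightarrow> (\<exists>A\<in>{A \<in> Pow W. \<Phi> A}. \<forall>z. z \<in> A \<longleftrightarrow> z \<in> Z \<and> (\<forall>w. w \<in> cluster adj {z} Z \<longrightarrow> w \<in> W))" for Z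
  proof -
    have "(\<forall>z. z \<in> A \<longleftrightarrow> z \<in> Z \<and> (\<forall>w. w \<in> cluster adj {z} Z \<longrightarrow> w \<in> W)) \<longleftrightarrow> A = confined W Z" for A
      unfolding confined_def by blast
    then show ?thesis using sub by simp
  qed
  moreover have "Measurable.pred (site_measure p) (\<lambda>\<omega>. \<exists>A\<in>{A \<in> Pow W. \<Phi> A}.
      \<forall>z. z \<in> A \<longleftrightarrow> z \<in> black \<omega> \<and> (\<forall>w. w \<in> cluster adj {z} (black \<omega>) \<longrightarrow> w \<in> W))"
    by (rule pred_intros_finite) (use assms in simp, measurable)
  ultimately show ?thesis by simp
qed

lemma pred_isolated:
  fixes z :: "int ^ 'd::finite"
  shows "Measurable.pred (site_measure p) (\<lambda>\<omega>. isolated z (black \<omega>))"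
  unfolding isolated_def using finite_around by (rule pred_local[where P = "\<lambda>A. A = {z}"])

lemma pred_large_cluster_within:
  fixes z :: "int ^ 'd::finite"
  assumes "finite W"
  shows "Measurable.pred (site_measure p) (\<lambda>\<omega>. large_cluster_within W m z (black \<omega>))"
  unfolding large_cluster_within_def using assms
  by (rule pred_local[where P = "\<lambda>A. m \<le> card (cluster adj {z} A)"])

text \<open>If \<open>\<mu> T\<close> exceeded \<open>b\<close>, the empirical measure would differ from \<open>\<mu>\<close> by a fixed amount on the events
\<open>G L\<close>, whose probability stays above \<open>c\<close>. This contradicts convergence in probability, provided that
the exceptional event is measurable: a non-measurable set has measure zero by convention and
the convergence would say nothing. Measurability holds because the empirical measure is a function
of the confined set.\<close>

lemma limit_measure_le:
  fixes \<nu> \<mu> :: "(real ^ 'd) set set pmf"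
  assumes lim: "is_limit_measure p \<nu> \<mu>" and "0 < c"
    and sets: "\<And>L. L \<ge> 1 \<Longrightarrow> G L \<in> sets (site_measure p)"
    and G: "\<And>L. L \<ge> 1 \<Longrightarrow> c \<le> measure (site_measure p) (G L)"
    and bound: "\<And>L \<omega>. L \<ge> 1 \<Longrightarrow> \<omega> \<in> G L \<Longrightarrow> measure_pmf.prob (empirical_measure \<nu> L (black \<omega>)) T \<le> b"
  shows "measure_pmf.prob \<mu> T \<le> b"
proof (rule ccontr)
  interpret prob_space "site_measure p :: (int ^ 'd \<Rightarrow> bool) measure" by (rule prob_space_site_measure)
  assume "\<not> measure_pmf.prob \<mu> T \<le> b"
  define \<epsilon> where "\<epsilon> = (measure_pmf.prob \<mu> T - b) / 2"
  have \<epsilon>: "\<epsilon> > 0" "b + \<epsilon> < measure_pmf.prob \<mu> T" using \<open>\<not> _\<close> by (simp_all add: \<epsilon>_def field_simps)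
  let ?F = "\<lambda>L. {\<omega> \<in> space (site_measure p). tv_dist (empirical_measure \<nu> L (black \<omega>)) \<mu> > \<epsilon>}"
  have "(\<lambda>L. measure (site_measure p) (?F L)) \<longlonglongrightarrow> 0"
    using lim \<epsilon>(1) unfolding is_limit_measure_def by blast
  then have "eventually (\<lambda>L. measure (site_measure p) (?F L) < c) sequentially"
    using \<open>0 < c\<close> by (rule order_tendstoD)
  then obtain N where N: "\<And>L. L \<ge> N \<Longrightarrow> measure (site_measure p) (?F L) < c"
    by (auto simp: eventually_sequentially)
  define L where "L = max N 1"
  have L: "L \<ge> N" "L \<ge> 1" by (auto simp: L_def)
  have "empirical_measure \<nu> L Z = (let Y = confined (window_cubes L) Z in
      if clusters Y = {} then \<nu> else map_pmf homotopy_type (pmf_of_set (cubical_set ` clusters Y)))" for Z :: "(int ^ 'd) set"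
    by (simp add: empirical_measure_def components_windowed_set)
  then have "Measurable.pred (site_measure p) (\<lambda>\<omega>. tv_dist (empirical_measure \<nu> L (black \<omega>)) \<mu> > \<epsilon>)"
    using pred_confined[OF finite_window_cubes[of L], where p = p and \<Phi> = "\<lambda>Y. tv_dist
      (if clusters Y = {} then \<nu> else map_pmf homotopy_type (pmf_of_set (cubical_set ` clusters Y))) \<mu> > \<epsilon>"]
    by (simp add: Let_def)
  then have F: "?F L \<in> events" by (simp add: pred_def)
  have "G L \<subseteq> ?F L"
  proof
    fix \<omega> assume "\<omega> \<in> G L"
    then have "measure_pmf.prob (empirical_measure \<nu> L (black \<omega>)) T \<le> b" using bound L by blast
    then have "\<epsilon> < \<bar>measure_pmf.prob (empirical_measure \<nu> L (black \<omega>)) T - measure_pmf.prob \<mu> T\<bar>"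
      using \<epsilon> by simp
    also have "\<dots> \<le> tv_dist (empirical_measure \<nu> L (black \<omega>)) \<mu>" by (rule tv_dist_ge)
    finally show "\<omega> \<in> ?F L" by (simp add: space_site_measure)
  qed
  then have "prob (G L) \<le> prob (?F L)" using F by (rule finite_measure_mono)
  then show False using G[OF L(2)] N[OF L(1)] by linarith
qed

lemma (in prob_space) prob_pos_ge_expectation:
  fixes f :: "'a \<Rightarrow> real"
  assumes "integrable M f" "\<And>x. f x \<le> 1"
  shows "expectation f \<le> prob {x \<in> space M. f x > 0}"
proof -
  have "{x \<in> space M. f x > 0} \<in> events" using assms(1) by measurable
  then have "expectation f \<le> expectation (indicator {x \<in> space M. f x > 0})"
    using assms by (intro integral_mono integrable_real_indicator) (auto simp: indicator_def emeasure_eq_measure)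
  moreover have "{x \<in> space M. f x > 0} \<inter> space M = {x \<in> space M. f x > 0}" by blast
  ultimately show ?thesis by simp
qed

text \<open>The average over \<open>W\<close> of \<open>1\<^sub>P - \<eta> * 1\<^sub>Q - \<tau>\<close> is at most one, so it is positive with
probability at least its expectation.\<close>

lemma favourable_event:
  fixes W :: "(int ^ 'd::finite) set" and \<eta> \<tau> \<rho> \<kappa> :: real
    and P Q :: "int ^ 'd \<Rightarrow> (int ^ 'd) set \<Rightarrow> bool"
  assumes W: "finite W" "W \<noteq> {}" and "0 \<le> \<eta>" "0 \<le> \<tau>"
    and P: "\<And>z. Measurable.pred (site_measure p) (\<lambda>\<omega>. P z (black \<omega>))"
    and Q: "\<And>z. Measurable.pred (site_measure p) (\<lambda>\<omega>. Q z (black \<omega>))"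
    and P_ge: "\<And>z. z \<in> W \<Longrightarrow> \<rho> \<le> measure (site_measure p) {\<omega>. P z (black \<omega>)}"
    and Q_le: "\<And>z. z \<in> W \<Longrightarrow> measure (site_measure p) {\<omega>. Q z (black \<omega>)} \<le> \<kappa>"
  defines "G \<equiv> {\<omega>. real (card {z \<in> W. P z (black \<omega>)}) - \<eta> * card {z \<in> W. Q z (black \<omega>)} > \<tau> * card W}"
  shows "G \<in> sets (site_measure p)" "\<rho> - \<eta> * \<kappa> - \<tau> \<le> measure (site_measure p) G"
proof -
  interpret prob_space "site_measure p :: (int ^ 'd \<Rightarrow> bool) measure" by (rule prob_space_site_measure)
  define IP where "IP = (\<lambda>z. {\<omega>. P z (black \<omega>)})"
  define IQ where "IQ = (\<lambda>z. {\<omega>. Q z (black \<omega>)})"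
  define f :: "(int ^ 'd \<Rightarrow> bool) \<Rightarrow> real" where
    "f = (\<lambda>\<omega>. (\<Sum>z\<in>W. indicat_real (IP z) \<omega> - \<eta> * indicat_real (IQ z) \<omega> - \<tau>) / card W)"
  have N: "0 < real (card W)" using W by (simp add: card_gt_0_iff)
  have [measurable]: "IP z \<in> events" "IQ z \<in> events" for z
    using P[of z] Q[of z] by (auto simp: pred_def space_site_measure IP_def IQ_def)
  have int: "integrable (site_measure p) (indicator (IP z) :: _ \<Rightarrow> real)"
    "integrable (site_measure p) (indicator (IQ z) :: _ \<Rightarrow> real)" for z
    by (auto intro!: integrable_real_indicator simp: emeasure_eq_measure)
  have intf: "integrable (site_measure p) f"
    unfolding f_def by (intro integrable_divide Bochner_Integration.integrable_sum
      Bochner_Integration.integrable_diff integrable_mult_right int integrable_const)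
  have f_eq: "f \<omega> = (real (card {z \<in> W. P z (black \<omega>)}) - \<eta> * card {z \<in> W. Q z (black \<omega>)} - \<tau> * card W) / card W" for \<omega>
  proof -
    have "(\<Sum>z\<in>W. indicator (IP z) \<omega> :: real) = card {z \<in> W. P z (black \<omega>)}"
      using W by (simp add: IP_def indicator_def sum.If_cases Int_def conj_commute)
    moreover have "(\<Sum>z\<in>W. indicator (IQ z) \<omega> :: real) = card {z \<in> W. Q z (black \<omega>)}"
      using W by (simp add: IQ_def indicator_def sum.If_cases Int_def conj_commute)
    ultimately show ?thesis
      unfolding f_def sum_subtractf sum_distrib_left[symmetric] by (simp add: mult.commute)
  qed
  have G: "G = {\<omega> \<in> space (site_measure p). f \<omega> > 0}"
    using N by (auto simp: G_def f_eq space_site_measure zero_less_divide_iff)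
  show "G \<in> events" unfolding G using intf by measurable
  have "(\<rho> - \<eta> * \<kappa> - \<tau>) = (\<Sum>z\<in>W. \<rho> - \<eta> * \<kappa> - \<tau>) / card W" using N by simp
  also have "\<dots> \<le> (\<Sum>z\<in>W. prob (IP z) - \<eta> * prob (IQ z) - \<tau>) / card W"
    using P_ge Q_le \<open>0 \<le> \<eta>\<close> unfolding IP_def IQ_def
    by (intro divide_right_mono sum_mono diff_mono mult_left_mono) auto
  also have "\<dots> = expectation f"
    unfolding f_def by (simp add: int Bochner_Integration.integral_sum Bochner_Integration.integral_diff
        prob_space)
  also have "\<dots> \<le> prob {\<omega> \<in> space (site_measure p). f \<omega> > 0}"
  proof (rule prob_pos_ge_expectation[OF intf])
    fix \<omega>
    have "(\<Sum>z\<in>W. indicat_real (IP z) \<omega> - \<eta> * indicat_real (IQ z) \<omega> - \<tau>) \<le> (\<Sum>z\<in>W. 1 :: real)"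
      using assms(3,4) by (intro sum_mono) (auto simp: indicator_def)
    then show "f \<omega> \<le> 1" using N by (simp add: f_def divide_le_eq)
  qed
  finally show "\<rho> - \<eta> * \<kappa> - \<tau> \<le> prob G" unfolding G .
qed

text \<open>The geometric bound is at most \<open>C / s * exp (- \<sigma> * n)\<close> with \<open>\<sigma> = - ln s / D\<close>. Half of the rate \<open>\<sigma>\<close>
absorbs the constant when \<open>n\<close> is beyond some \<open>N\<close>; up to \<open>N\<close> the bound \<open>c < 1\<close> is used.\<close>

lemma exponential_bound:
  fixes s C c :: real and D :: nat
  assumes s: "0 < s" "s < 1" and "0 < C" and c: "0 < c" "c < 1" and D: "0 < D"
  shows "\<exists>\<alpha>>0. \<forall>n\<ge>1. \<forall>x. x \<le> c \<and> x \<le> C * s ^ (n div D) \<longrightarrow> x \<le> exp (- \<alpha> * real n)"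
proof -
  define \<sigma> where "\<sigma> = - ln s / D"
  have \<sigma>: "\<sigma> > 0" using s D by (simp add: \<sigma>_def divide_less_0_iff)
  have ln_s: "ln s = - \<sigma> * D" using D by (simp add: \<sigma>_def)
  obtain N :: nat where N: "2 * ln (C / s) / \<sigma> \<le> N" "N \<ge> 1"
    by (meson le_max_iff_disj max.cobounded2 of_nat_le_iff order_trans real_arch_simple)
  define \<alpha> where "\<alpha> = min (\<sigma> / 2) (- ln c / N)"
  have "\<alpha> > 0" using \<sigma> c N by (simp add: \<alpha>_def divide_less_0_iff)
  moreover have "x \<le> exp (- \<alpha> * real n)" if "x \<le> c" "x \<le> C * s ^ (n div D)" for n x
  proof (cases "n \<le> N")
    case True
    have "\<alpha> * real n \<le> (- ln c / N) * N"
      using True \<open>\<alpha> > 0\<close> by (intro mult_mono) (auto simp: \<alpha>_def)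
    then have "ln c \<le> - \<alpha> * real n" using N by simp
    then have "c \<le> exp (- \<alpha> * real n)" using c by (metis exp_le_cancel_iff exp_ln)
    then show ?thesis using that by simp
  next
    case False
    have "real n \<le> D * (real (n div D) + 1)"
    proof -
      have "n < D * (n div D + 1)" using D by (simp add: dividend_less_times_div)
      then have "real n \<le> real (D * (n div D + 1))" by (simp only: of_nat_le_iff less_imp_le)
      then show ?thesis by (simp add: distrib_left)
    qed
    then have "\<sigma> * real n \<le> \<sigma> * (D * (real (n div D) + 1))" using \<sigma> by (intro mult_left_mono) auto
    then have "ln s * real (n div D) \<le> - \<sigma> * real n - ln s"
      unfolding ln_s by (simp add: algebra_simps)
    moreover have "2 * ln (C / s) \<le> \<sigma> * real n"
    proof -
      have "2 * ln (C / s) / \<sigma> \<le> real n" using N False by linarith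
      then show ?thesis using \<sigma> by (simp add: field_simps)
    qed
    ultimately have "ln C + ln s * real (n div D) \<le> - (\<sigma> / 2) * real n"
      using s \<open>0 < C\<close> by (simp add: ln_div)
    also have "\<dots> \<le> - \<alpha> * real n" using min.cobounded1[of "\<sigma> / 2" "- ln c / N"] by (intro mult_right_mono) (auto simp: \<alpha>_def)
    finally have "exp (ln C + ln s * real (n div D)) \<le> exp (- \<alpha> * real n)" by simp
    moreover have "exp (ln C + ln s * real (n div D)) = C * s ^ (n div D)"
      using s \<open>0 < C\<close> by (simp add: exp_add exp_of_nat2_mult)
    ultimately show ?thesis using that by simp
  qed
  ultimately show ?thesis by blast
qed

theorem theorem1p2:
  fixes p :: real and k :: nat
  assumes "CARD('d::finite) \<ge> 2"
    and "0 < k" and "k < CARD('d)"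
    and "0 < p" and "p < critical_probability TYPE('d)"
  shows "\<exists>\<alpha>>0. \<forall>\<nu> \<mu> :: (real ^ 'd) set set pmf.
           set_pmf \<nu> \<subseteq> homotopy_types \<and> is_limit_measure p \<nu> \<mu> \<longrightarrow>
           (\<forall>n\<ge>1. measure_pmf.prob \<mu> (betti_tail k n) \<le> exp (- \<alpha> * real n))"
proof -
  have p1: "p < 1" using theta_below_critical[OF assms(4,5)] by (metis less_le_trans)
  obtain s K :: real where s: "0 < s" "s < 1" and K: "0 < K"
    and decay: "\<And>(R :: (int ^ 'd) set) v m. finite R \<Longrightarrow> v \<notin> R \<Longrightarrow>
       site_expectation p R (\<lambda>A. of_bool (m \<le> card (cluster adj {v} A))) \<le> K * s ^ m"
    using subcritical_volume_decay[OF assms(4,5)] by metis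
  obtain D :: nat where D: "D > 0"
    "\<And>k (F :: (int ^ 'd::finite) set). finite F \<Longrightarrow> betti k (cubical_set F) \<le> enat (D * card F)"
    using betti_le_card by blast
  define \<rho> where "\<rho> = p * (1 - p) ^ (card (around (0 :: int ^ 'd)) - 1)"
  have \<rho>: "0 < \<rho>" using assms(4) p1 by (simp add: \<rho>_def)
  have \<rho>_eq: "measure (site_measure p) {\<omega>. isolated z (black \<omega>)} = \<rho>" for z :: "int ^ 'd"
    using measure_isolated[of p z] assms(4) p1 by (simp add: \<rho>_def)
  have "\<rho> \<le> p * 1" unfolding \<rho>_def using assms(4) p1 by (intro mult_left_mono power_le_one) auto
  then have \<rho>1: "\<rho> < 1" using p1 by simp
  have W: "finite (window_cubes L :: (int ^ 'd) set)" for L by (rule finite_window_cubes)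
  have Wne: "(window_cubes L :: (int ^ 'd) set) \<noteq> {}" if "L \<ge> 1" for L
    using zero_in_window_cubes[OF that] by blast
  have large: "measure_pmf.prob \<mu> (betti_tail k n) \<le> 2 * K / \<rho> * s ^ (n div D)"
    if lim: "is_limit_measure p \<nu> \<mu>" for \<nu> \<mu> :: "(real ^ 'd) set set pmf" and n
  proof -
    define \<kappa> where "\<kappa> = K * s ^ (n div D)"
    have \<kappa>: "0 < \<kappa>" using K s by (simp add: \<kappa>_def)
    \<comment> \<open>With this weight large clusters cost half of the density of the isolated cubes.\<close>
    define \<eta> where "\<eta> = \<rho> / (2 * \<kappa>)"
    have \<eta>: "0 < \<eta>" using \<rho> \<kappa> by (simp add: \<eta>_def)
    define G where "G = (\<lambda>L. {\<omega> :: int ^ 'd \<Rightarrow> bool. real (card {z \<in> window_cubes L. isolated z (black \<omega>)})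
      - \<eta> * card {z \<in> window_cubes L. large_cluster_within (window_cubes L) (n div D) z (black \<omega>)}
        > (0::real) * card (window_cubes L :: (int ^ 'd) set)})"
    have Q: "measure (site_measure p) {\<omega>. large_cluster_within W' (n div D) z (black \<omega>)} \<le> \<kappa>"
      if "finite W'" for W' and z :: "int ^ 'd"
      using measure_large_cluster_within[of p W' "n div D" z] decay[of "W' - {z}" z "n div D"] that assms(4) p1
      by (simp add: \<kappa>_def)
    have c: "0 < \<rho> / 2" "\<rho> - \<eta> * \<kappa> - 0 = \<rho> / 2" using \<rho> \<kappa> by (auto simp: \<eta>_def)
    have "measure_pmf.prob \<mu> (betti_tail k n) \<le> 1 / \<eta>"
    proof (rule limit_measure_le[OF lim c(1), where G = G])
      fix L :: nat assume L: "L \<ge> 1"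
      note fav = favourable_event[OF W Wne[OF L] less_imp_le[OF \<eta>] order_refl
          pred_isolated pred_large_cluster_within[OF W[of L]] eq_refl[OF \<rho>_eq[symmetric]] Q[OF W[of L]]]
      show "G L \<in> sets (site_measure p)" unfolding G_def by (rule fav(1))
      from fav(2) show "\<rho> / 2 \<le> measure (site_measure p) (G L)" unfolding G_def c(2) .
      fix \<omega> assume "\<omega> \<in> G L"
      let ?X = "card {z \<in> window_cubes L. isolated z (black \<omega>)}"
      let ?Y = "card {z \<in> window_cubes L. large_cluster_within (window_cubes L) (n div D) z (black \<omega>)}"
      have XY: "\<eta> * ?Y < ?X" using \<open>\<omega> \<in> G L\<close> by (simp add: G_def)
      moreover have "0 \<le> \<eta> * ?Y" using \<eta> by simp
      ultimately have X: "0 < ?X" by linarith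
      have "measure_pmf.prob (empirical_measure \<nu> L (black \<omega>)) (betti_tail k n) \<le> ?Y / ?X"
        using D X by (intro prob_empirical_betti_tail_le)
      also have "\<dots> \<le> 1 / \<eta>" using XY X \<eta> by (simp add: field_simps)
      finally show "measure_pmf.prob (empirical_measure \<nu> L (black \<omega>)) (betti_tail k n) \<le> 1 / \<eta>" .
    qed
    then show ?thesis by (simp add: \<eta>_def \<kappa>_def)
  qed
  have small: "measure_pmf.prob \<mu> (betti_tail k n) \<le> 1 - \<rho> / 2"
    if lim: "is_limit_measure p \<nu> \<mu>" and n: "1 \<le> n" for \<nu> \<mu> :: "(real ^ 'd) set set pmf" and n
  proof -
    define G where "G = (\<lambda>L. {\<omega> :: int ^ 'd \<Rightarrow> bool. real (card {z \<in> window_cubes L. isolated z (black \<omega>)})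
      - (0::real) * card {z \<in> window_cubes L. isolated z (black \<omega>)}
        > \<rho> / 2 * card (window_cubes L :: (int ^ 'd) set)})"
    have c: "0 < \<rho> / 2" "\<rho> - 0 * 1 - \<rho> / 2 = \<rho> / 2" using \<rho> by auto
    have Q: "measure (site_measure p) {\<omega>. isolated z (black \<omega>)} \<le> 1" for z :: "int ^ 'd"
      using \<rho>_eq \<rho>1 by simp
    show ?thesis
    proof (rule limit_measure_le[OF lim c(1), where G = G])
      fix L :: nat assume L: "L \<ge> 1"
      note fav = favourable_event[OF W Wne[OF L] order_refl less_imp_le[OF c(1)]
          pred_isolated pred_isolated eq_refl[OF \<rho>_eq[symmetric]] Q]
      show "G L \<in> sets (site_measure p)" unfolding G_def by (rule fav(1))
      from fav(2) show "\<rho> / 2 \<le> measure (site_measure p) (G L)" unfolding G_def c(2) .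
      fix \<omega> assume "\<omega> \<in> G L"
      let ?X = "card {z \<in> window_cubes L. isolated z (black \<omega>)}"
      have N: "0 < real (card (window_cubes L :: (int ^ 'd) set))" using W Wne[OF L] by (simp add: card_gt_0_iff)
      have XN: "\<rho> / 2 * card (window_cubes L :: (int ^ 'd) set) < ?X" using \<open>\<omega> \<in> G L\<close> by (simp add: G_def)
      moreover have "0 < \<rho> / 2 * card (window_cubes L :: (int ^ 'd) set)" using \<rho> N by simp
      ultimately have X: "0 < ?X" by linarith
      have "measure_pmf.prob (empirical_measure \<nu> L (black \<omega>)) (betti_tail k n)
          \<le> 1 - ?X / card (window_cubes L :: (int ^ 'd) set)"
        using assms(2) n X by (rule prob_empirical_betti_tail_le_isolated)
      also have "\<dots> \<le> 1 - \<rho> / 2" using XN N by (simp add: field_simps)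
      finally show "measure_pmf.prob (empirical_measure \<nu> L (black \<omega>)) (betti_tail k n) \<le> 1 - \<rho> / 2" .
    qed
  qed
  obtain \<alpha> where \<alpha>: "\<alpha> > 0"
    "\<And>n x. n \<ge> 1 \<Longrightarrow> x \<le> 1 - \<rho> / 2 \<Longrightarrow> x \<le> 2 * K / \<rho> * s ^ (n div D) \<Longrightarrow> x \<le> exp (- \<alpha> * real n)"
    using exponential_bound[OF s, of "2 * K / \<rho>" "1 - \<rho> / 2" D] K \<rho> \<rho>1 D by auto
  then show ?thesis using large small by blast
qed

end
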